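(* Let $0<c<\log 2$ and $\varepsilon>0$. Then for all sufficiently large positive integers $m$, $$F\left(m,\frac{cm}{\log m}\right)<\exp\left(cm+\frac{\varepsilon\, m\log\log m}{\log m}\right).$$
   Context: An addition chain of length $k$ is a sequence of integers $1=a_0<a_1<\cdots<a_k$ such that for each $1\le j\le k$ there are indices $0\le i,s<j$ with $a_j=a_s+a_i$; it leads to $a_k$. For a positive integer $n$, $\ell(n)$ denotes the minimal length of an addition chain leading to $n$. For a positive integer $m$ and a real $r\ge 0$, $F(m,r):=\#\{n\in[2^m,2^{m+1}) : \ell(n)\le m+r\}$. Here $\log$ is the natural logarithm. *)

theory Defs
  imports Complex_Main
begin

text \<open>Only the values \<open>a 0, \<dots>, a k\<close> matter. The terms are positive integers, since
  \<open>a 0 = 1\<close> and the sequence is increasing, so \<^typ>\<open>nat\<close> suffices.\<close>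

definition addition_chain :: "(nat \<Rightarrow> nat) \<Rightarrow> nat \<Rightarrow> bool" where
  "addition_chain a k \<longleftrightarrow>
     a 0 = 1 \<and>
     (\<forall>j<k. a j < a (Suc j)) \<and>
     (\<forall>j\<in>{1..k}. \<exists>i s. i < j \<and> s < j \<and> a j = a s + a i)"

definition chain_length :: "nat \<Rightarrow> nat" where
  "chain_length n = (LEAST k. \<exists>a. addition_chain a k \<and> a k = n)"

lemma addition_chain_exists:
  assumes "n \<ge> 1"
  shows "\<exists>k a. addition_chain a k \<and> a k = n"
proof (intro exI conjI)
  show "addition_chain Suc (n - 1)"
    unfolding addition_chain_def
  proof (intro conjI ballI)
    fix j assume "j \<in> {1..n - 1}"
    then have "j - 1 < j" "0 < j" "Suc j = Suc 0 + Suc (j - 1)" by auto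
    then show "\<exists>i s. i < j \<and> s < j \<and> Suc j = Suc s + Suc i" by blast
  qed auto
  show "Suc (n - 1) = n" using assms by simp
qed

lemma chain_length_attained:
  assumes "n \<ge> 1"
  shows "\<exists>a. addition_chain a (chain_length n) \<and> a (chain_length n) = n"
  unfolding chain_length_def by (rule LeastI_ex) (rule addition_chain_exists[OF assms])

definition F :: "nat \<Rightarrow> real \<Rightarrow> nat" where
  "F m r = card {n \<in> {2 ^ m ..< 2 ^ (m + 1)}. real (chain_length n) \<le> real m + r}"

end

theory Submission
  imports Defs "HOL-Library.FuncSet" "HOL-Library.Infinite_Set" "HOL-Real_Asymp.Real_Asymp"
begin

text \<open>
  Let \<open>r = c m / log m\<close> and \<open>B \<approx> log m\<close>. A chain \<open>a\<close> of length \<open>k \<le> m + r\<close> leading to \<open>n \<ge> 2 ^ m\<close> has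
  total loss \<open>\<Sum>j. 1 - log 2 (a j / a (j - 1)) \<le> r\<close>, so all but \<open>O(r)\<close> of its steps are doublings.
  Non-doublings \<open>a j = a s + a i\<close> with \<open>a j \<le> (1 + 1/B) a (j - 1)\<close> are tiny and lose almost 1, those
  with \<open>a j > 3/2 a (j - 1)\<close> are big, the others are medium and lose at least \<open>2/5\<close>. We have to encode \<open>n\<close>
  so that a tiny step costs a factor \<open>O(m)\<close>, a medium step a power of \<open>log m\<close> and everything else \<open>exp (O(r))\<close>.

  No doubling lies strictly between \<open>s\<close> and \<open>j\<close>, nor between \<open>i\<close> and \<open>j\<close> at a big step. At medium and big
  steps the ratios \<open>a j / a (j - 1)\<close> and \<open>a i / a (j - 1)\<close> are bounded below, which bounds the sum of the
  offsets \<open>j - i\<close>, hence the number of offset sequences. At tiny steps the pairs \<open>(s, i)\<close> are recorded as an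
  unordered set (Erdos): as the chain increases, the order can be recovered. There are \<open>O(r)\<close>
  choices for \<open>s\<close> and \<open>O(m)\<close> for \<open>i\<close>, and forgetting the order saves a factor \<open>\<approx> r\<close> per step.

  Recording the positions of the runs of non-doublings exactly would cost a factor \<open>log m\<close> per run.
  Instead each run is multiplied by a power of 2 below \<open>2 ^ B\<close>, so that the number of doublings before it
  becomes a multiple of \<open>B\<close>; the rounded positions cost only \<open>exp (O(r + m/B))\<close>. The summands \<open>a i\<close> are
  then known up to \<open>O(B)\<close> further doublings in either direction, but these additional candidates number
  only \<open>O(B r) = O(m)\<close>. The final value equals \<open>n\<close> up to a power of 2, and \<open>n\<close> lies in a dyadic interval.
\<close>

section \<open>Counting sequences and subsets\<close>

text \<open>Extensional functions, fixed outside \<open>A\<close>, so that sequences on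
  \<open>A\<close> are counted once and the set is finite.\<close>

definition bounded_seqs :: "'a set \<Rightarrow> nat \<Rightarrow> ('a \<Rightarrow> nat) set" where
  "bounded_seqs A S = {f \<in> A \<rightarrow>\<^sub>E UNIV. sum f A \<le> S}"

lemma bounded_seqs_subset:
  assumes "finite A"
  shows "bounded_seqs A S \<subseteq> A \<rightarrow>\<^sub>E {..S}"
proof
  fix f assume f: "f \<in> bounded_seqs A S"
  have "f x \<le> S" if "x \<in> A" for x
    using f member_le_sum[of x A f] assms that by (auto simp: bounded_seqs_def)
  then show "f \<in> A \<rightarrow>\<^sub>E {..S}"
    using f by (auto simp: bounded_seqs_def PiE_def)
qed

lemma finite_bounded_seqs: "finite A \<Longrightarrow> finite (bounded_seqs A S)"
  by (rule finite_subset[OF bounded_seqs_subset]) (auto intro: finite_PiE)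

lemma restrict_in_bounded_seqs:
  assumes "sum f A \<le> S"
  shows "restrict f A \<in> bounded_seqs A S"
  using assms by (auto simp: bounded_seqs_def)

text \<open>Generating function bound: \<open>z ^ S \<le> z ^ sum f A\<close>, and the sum of these
  weights factors into geometric series. The parameter \<open>z\<close> stays free:
  \<open>1 / 2\<close> serves when \<open>S\<close> is comparable to \<open>card A\<close>, a value
  near 1 when \<open>S\<close> is much larger.\<close>

lemma card_bounded_seqs_le:
  fixes z :: real
  assumes A: "finite A" and z: "0 < z" "z < 1"
  shows "real (card (bounded_seqs A S)) \<le> (1 / z) ^ S * (1 / (1 - z)) ^ card A"
proof -
  have "real (card (bounded_seqs A S)) * z ^ S = (\<Sum>f\<in>bounded_seqs A S. z ^ S)"
    by simp
  also have "\<dots> \<le> (\<Sum>f\<in>bounded_seqs A S. \<Prod>x\<in>A. z ^ f x)"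
    using z by (intro sum_mono) (auto simp: bounded_seqs_def power_decreasing simp flip: power_sum)
  also have "\<dots> \<le> (\<Sum>f\<in>A \<rightarrow>\<^sub>E {..S}. \<Prod>x\<in>A. z ^ f x)"
    using z A by (intro sum_mono2 bounded_seqs_subset finite_PiE prod_nonneg) auto
  also have "\<dots> = (\<Prod>x\<in>A. \<Sum>y\<le>S. z ^ y)"
    using A by (subst prod_sum_PiE) auto
  also have "\<dots> \<le> (\<Prod>x\<in>A. 1 / (1 - z))"
  proof (intro prod_mono conjI)
    have "(\<Sum>y\<le>S. z ^ y) = (1 - z ^ Suc S) / (1 - z)"
      using z by (simp add: sum_gp0)
    then show "(\<Sum>y\<le>S. z ^ y) \<le> 1 / (1 - z)"
      using z by (simp add: divide_right_mono)
  qed (use z in \<open>auto intro: sum_nonneg\<close>)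
  finally have "real (card (bounded_seqs A S)) * z ^ S \<le> (1 / (1 - z)) ^ card A"
    by simp
  then show ?thesis
    using z by (simp add: field_simps power_divide)
qed

text \<open>The same weighting with \<open>(1 / N) ^ card P\<close>, whose total over all subsets is
  \<open>(1 + 1 / N) ^ card U\<close>. For \<open>card U \<le> T * N\<close> the bound is
  \<open>N ^ a * exp T\<close>: forgetting the order of the elements has removed the factor
  \<open>T\<close> per element.\<close>

lemma card_small_subsets_le:
  fixes N :: real
  assumes U: "finite U" and N: "N \<ge> 1"
  shows "real (card {P. P \<subseteq> U \<and> card P \<le> a}) \<le> N ^ a * exp (real (card U) / N)"
proof -
  have "real (card {P. P \<subseteq> U \<and> card P \<le> a}) * (1 / N) ^ a = (\<Sum>P | P \<subseteq> U \<and> card P \<le> a. (1 / N) ^ a)"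
    by simp
  also have "\<dots> \<le> (\<Sum>P | P \<subseteq> U \<and> card P \<le> a. (1 / N) ^ card P)"
    using N by (intro sum_mono power_decreasing) auto
  also have "\<dots> \<le> (\<Sum>P\<in>Pow U. (1 / N) ^ card P)"
    using N U by (intro sum_mono2) auto
  also have "\<dots> = (\<Prod>x\<in>U. 1 / N + 1)"
    by (subst prod_add[OF U]) (auto intro!: sum.cong)
  also have "\<dots> \<le> (\<Prod>x\<in>U. exp (1 / N))"
    using N by (intro prod_mono) (auto simp: add.commute)
  also have "\<dots> = exp (real (card U) / N)"
    by (simp flip: exp_of_nat_mult)
  finally show ?thesis
    using N by (simp add: field_simps power_divide)
qed

lemma card_Sigma_le:
  fixes M :: real
  assumes "finite A" and "\<And>a. a \<in> A \<Longrightarrow> finite (H a)"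
    and "\<And>a. a \<in> A \<Longrightarrow> real (card (H a)) \<le> M"
  shows "real (card (Sigma A H)) \<le> real (card A) * M"
proof -
  have "real (card (Sigma A H)) = (\<Sum>a\<in>A. real (card (H a)))"
    using assms by (simp add: card_SigmaI)
  also have "\<dots> \<le> real (card A) * M"
    using assms by (intro sum_bounded_above) auto
  finally show ?thesis .
qed

section \<open>Compressed chains\<close>

text \<open>Node \<open>l\<close> stands for the \<open>l\<close>-th non-doubling step; \<open>V l\<close> is its value times a power of 2
  and \<open>base B g V l\<close> the chain element just before it, scaled by the same power. Between two nodes
  the number of doublings is rounded to the multiple \<open>B * g l\<close> of \<open>B\<close>. A triple \<open>(p, q, e)\<close>
  names two summands; the second one is the element \<open>e - B\<close> doublings before \<open>base B g V q\<close>, up to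
  the change of scale, which can make \<open>e - B\<close> negative.\<close>

definition base :: "nat \<Rightarrow> (nat \<Rightarrow> nat) \<Rightarrow> (nat \<Rightarrow> real) \<Rightarrow> nat \<Rightarrow> real" where
  "base B g V l = 2 ^ (B * g l) * V (l - 1)"

definition node_val :: "nat \<Rightarrow> (nat \<Rightarrow> nat) \<Rightarrow> (nat \<Rightarrow> real) \<Rightarrow> nat \<times> nat \<times> nat \<Rightarrow> real" where
  "node_val B g V = (\<lambda>(p, q, e). base B g V p + base B g V q * 2 ^ B / 2 ^ e)"

definition compressed_chain ::
  "nat \<Rightarrow> nat \<Rightarrow> (nat \<Rightarrow> nat) \<Rightarrow> (nat \<Rightarrow> real) \<Rightarrow> (nat \<Rightarrow> nat) \<Rightarrow> (nat \<Rightarrow> nat) \<Rightarrow> (nat \<Rightarrow> nat) \<Rightarrow> bool"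
  where
  "compressed_chain B t g V p q e \<longleftrightarrow> V 0 = 1 \<and>
     (\<forall>l\<in>{1..t}. p l \<in> {1..l} \<and> q l \<in> {1..l} \<and> e l < 2 * B + B * g (q l) \<and>
        V l = node_val B g V (p l, q l, e l) \<and> base B g V l < V l)"

lemma compressed_chain_node:
  assumes "compressed_chain B t g V p q e" and "l \<in> {1..t}"
  shows "p l \<in> {1..l}" "q l \<in> {1..l}" "e l < 2 * B + B * g (q l)"
    "V l = node_val B g V (p l, q l, e l)" "base B g V l < V l"
  using assms unfolding compressed_chain_def by blast+

text \<open>As values are at least 1, scaling by a power of 2 does not decrease them, so
  \<open>V (l - 1) \<le> base B g V l < V l\<close>. The last claim lets an unordered triple be
  assigned to its node.\<close>

lemma compressed_chain_mono:
  assumes "compressed_chain B t g V p q e" and "l \<le> t"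
  shows "V l \<ge> 1" and "l' \<le> l \<Longrightarrow> V l' \<le> V l" and "l' < l \<Longrightarrow> V l' \<le> base B g V l"
proof -
  have base_ge: "V (l - 1) \<le> base B g V l" if "V (l - 1) \<ge> 1" for l
    using that by (simp add: base_def)
  have step: "V (Suc i) > base B g V (Suc i)" if "i < t" for i
    using compressed_chain_node(5)[OF assms(1)] that by simp
  have pos: "V i \<ge> 1" if "i \<le> t" for i
    using that
  proof (induction i)
    case 0
    then show ?case using assms by (simp add: compressed_chain_def)
  next
    case (Suc i)
    then show ?case using step[of i] base_ge[of "Suc i"] by force
  qed
  then show "V l \<ge> 1" using assms by simp
  have mono: "V l' \<le> V i" if "i \<le> t" "l' \<le> i" for i l'
    using that(2,1)
  proof (induction i rule: dec_induct)
    case (step i)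
    then show ?case using \<open>\<And>i. i < t \<Longrightarrow> V (Suc i) > _ i\<close>[of i] base_ge[of "Suc i"] pos[of i] by force
  qed simp
  show "V l' \<le> V l" if "l' \<le> l" using mono assms that by simp
  show "V l' \<le> base B g V l" if "l' < l"
    using mono[of "l - 1" l'] base_ge[of l] pos[of "l - 1"] assms that by force
qed

text \<open>The triples at nodes in \<open>A\<close> are known only as a set. Since \<open>V\<close> increases, the value at such
  a node is the least value of an available triple exceeding the base of the node.\<close>

lemma compressed_chain_unique:
  assumes c: "compressed_chain B t g V p q e" and c': "compressed_chain B t g' V' p' q' e'"
    and g: "\<And>l. l \<in> {1..t} \<Longrightarrow> g l = g' l"
    and A: "A \<subseteq> {1..t}"
    and P: "(\<lambda>l. (p l, q l, e l)) ` A = (\<lambda>l. (p' l, q' l, e' l)) ` A"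
    and out: "\<And>l. l \<in> {1..t} - A \<Longrightarrow> p l = p' l \<and> q l = q' l \<and> e l = e' l"
    and l: "l \<le> t"
  shows "V l = V' l"
  using l
proof (induction l rule: less_induct)
  case (less l)
  show ?case
  proof (cases "l = 0")
    case True
    then show ?thesis using c c' by (simp add: compressed_chain_def)
  next
    case False
    then have l: "l \<in> {1..t}" using less by auto
    \<comment> \<open>\<open>base\<close> at \<open>i\<close> involves only
      \<open>V (i - 1)\<close>, so the induction hypothesis covers \<open>i = l\<close> too.\<close>
    have base: "base B g V i = base B g' V' i" if "i \<in> {1..l}" for i
      using less g[of i] that by (auto simp: base_def)
    then have val: "node_val B g V (i, j, x) = node_val B g' V' (i, j, x)"
      if "i \<in> {1..l}" "j \<in> {1..l}" for i j x
      using that by (simp add: node_val_def)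
    \<comment> \<open>Stated for two arbitrary chains in order to be used in both directions. The
      triple of node \<open>l\<close> in the first chain sits at some \<open>l'\<close> in the
      second and has the same value there; since this value exceeds the common base,
      \<open>l' < l\<close> is impossible, and monotonicity of the second chain gives the
      inequality.\<close>
    have le: "V\<^sub>2 l \<le> V\<^sub>1 l"
      if c1: "compressed_chain B t g\<^sub>1 V\<^sub>1 p\<^sub>1 q\<^sub>1 e\<^sub>1" and c2: "compressed_chain B t g\<^sub>2 V\<^sub>2 p\<^sub>2 q\<^sub>2 e\<^sub>2"
        and b: "base B g\<^sub>1 V\<^sub>1 l = base B g\<^sub>2 V\<^sub>2 l"
        and v: "\<And>i j x. i \<in> {1..l} \<Longrightarrow> j \<in> {1..l} \<Longrightarrow> node_val B g\<^sub>1 V\<^sub>1 (i, j, x) = node_val B g\<^sub>2 V\<^sub>2 (i, j, x)"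
        and P: "(\<lambda>l. (p\<^sub>1 l, q\<^sub>1 l, e\<^sub>1 l)) ` A = (\<lambda>l. (p\<^sub>2 l, q\<^sub>2 l, e\<^sub>2 l)) ` A"
        and lA: "l \<in> A"
      for g\<^sub>1 g\<^sub>2 :: "nat \<Rightarrow> nat" and V\<^sub>1 V\<^sub>2 :: "nat \<Rightarrow> real" and p\<^sub>1 q\<^sub>1 e\<^sub>1 p\<^sub>2 q\<^sub>2 e\<^sub>2 :: "nat \<Rightarrow> nat"
    proof -
      obtain l' where l': "l' \<in> A" "p\<^sub>1 l = p\<^sub>2 l'" "q\<^sub>1 l = q\<^sub>2 l'" "e\<^sub>1 l = e\<^sub>2 l'"
        using lA P by (smt (verit) image_iff prod.inject)
      have *: "p\<^sub>1 l \<in> {1..l}" "q\<^sub>1 l \<in> {1..l}" "V\<^sub>1 l = node_val B g\<^sub>1 V\<^sub>1 (p\<^sub>1 l, q\<^sub>1 l, e\<^sub>1 l)"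
          "base B g\<^sub>1 V\<^sub>1 l < V\<^sub>1 l"
        using compressed_chain_node[OF c1 l] by simp_all
      have l't: "l' \<in> {1..t}" using A l' by auto
      have "V\<^sub>1 l = V\<^sub>2 l'"
        using compressed_chain_node(4)[OF c2 l't] *(1-3) v[of "p\<^sub>1 l" "q\<^sub>1 l" "e\<^sub>1 l"]
        unfolding l'(2-4) by simp
      moreover have "l \<le> l'"
      proof (rule ccontr)
        assume "\<not> l \<le> l'"
        then have "V\<^sub>2 l' \<le> base B g\<^sub>2 V\<^sub>2 l"
          using compressed_chain_mono(3)[OF c2, of l l'] l by auto
        then show False using *(4) b \<open>V\<^sub>1 l = V\<^sub>2 l'\<close> by simp
      qed
      ultimately show ?thesis
        using compressed_chain_mono(2)[OF c2, of l' l] l't by auto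
    qed
    show ?thesis
    proof (cases "l \<in> A")
      case True
      have "V' l \<le> V l" using le[OF c c' base val P True] l by auto
      moreover have "V l \<le> V' l"
        using le[OF c' c base[symmetric] val[symmetric] P[symmetric] True] l by auto
      ultimately show ?thesis by simp
    next
      case False
      then have *: "p l = p' l" "q l = q' l" "e l = e' l" using out[of l] l by auto
      have "V l = node_val B g V (p l, q l, e l)" "V' l = node_val B g' V' (p' l, q' l, e' l)"
          "p l \<in> {1..l}" "q l \<in> {1..l}"
        using compressed_chain_node[OF c l] compressed_chain_node(4)[OF c' l] by simp_all
      then show ?thesis using val[of "p l" "q l" "e l"] * by simp
    qed
  qed
qed

section \<open>Double counting, and two estimates for the binary logarithm\<close>

lemma sum_card_swap:
  assumes "finite A" and "finite H"
  shows "(\<Sum>j\<in>A. card {h \<in> H. R j h}) = (\<Sum>h\<in>H. card {j \<in> A. R j h})"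
proof -
  have "(\<Sum>j\<in>A. card {h \<in> H. R j h}) = (\<Sum>j\<in>A. \<Sum>h\<in>H. if R j h then 1 else 0)"
    using assms by (intro sum.cong refl) (simp add: sum.If_cases Collect_conj_eq)
  also have "\<dots> = (\<Sum>h\<in>H. \<Sum>j\<in>A. if R j h then 1 else 0)"
    by (rule sum.swap)
  also have "\<dots> = (\<Sum>h\<in>H. card {j \<in> A. R j h})"
    using assms by (intro sum.cong refl) (simp add: sum.If_cases Collect_conj_eq)
  finally show ?thesis .
qed

lemma log2_three_halves_le: "log 2 (3 / 2 :: real) \<le> 3 / 5"
proof -
  \<comment> \<open>The constant comes from \<open>(3 / 2) ^ 5 = 243 / 32 < 8\<close>.\<close>
  have "5 * log 2 (3 / 2 :: real) = log 2 ((3 / 2) ^ 5)"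
    by (simp add: log_nat_power)
  also have "\<dots> \<le> log 2 (2 ^ 3)"
    by (subst log_le_cancel_iff) (auto simp: power_divide)
  also have "\<dots> = 3"
    by (subst log_nat_power) auto
  finally show ?thesis by simp
qed

lemma log2_one_plus_le:
  assumes "(x::real) \<ge> 0"
  shows "log 2 (1 + x) \<le> 2 * x"
proof -
  have "exp (1 / 2 :: real) ^ 2 \<le> 2 ^ 2"
    using exp_le by (simp flip: exp_of_nat_mult)
  then have "exp (1 / 2 :: real) \<le> 2"
    by (rule power2_le_imp_le) simp
  then have "1 / 2 \<le> ln (2 :: real)"
    by (metis exp_gt_zero ln_exp ln_mono)
  then have "x * (1 / 2) \<le> x * ln 2"
    using assms by (rule mult_left_mono)
  moreover have "ln (1 + x) \<le> x" using assms by (rule ln_add_one_self_le_self)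
  ultimately show ?thesis
    by (simp add: log_def field_simps)
qed

section \<open>Losses in an addition chain\<close>

locale chain =
  fixes a :: "nat \<Rightarrow> nat" and k :: nat
  assumes chain: "addition_chain a k"
begin

lemma a_0: "a 0 = 1"
  using chain by (simp add: addition_chain_def)

lemma a_less: "i < j \<Longrightarrow> j \<le> k \<Longrightarrow> a i < a j"
proof (induction j)
  case (Suc j)
  have "a j < a (Suc j)" using chain Suc.prems by (simp add: addition_chain_def)
  then show ?case using Suc by (cases "i = j") auto
qed simp

lemma a_le: "i \<le> j \<Longrightarrow> j \<le> k \<Longrightarrow> a i \<le> a j"
  using a_less[of i j] by (cases "i = j") auto

lemma a_pos: "j \<le> k \<Longrightarrow> a j \<ge> 1"
  using a_le[of 0 j] a_0 by simp

lemma a_summands: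
  assumes "1 \<le> j" "j \<le> k"
  obtains s i where "i \<le> s" "s < j" "a j = a s + a i"
proof -
  obtain i s where "i < j" "s < j" "a j = a s + a i"
    using chain assms unfolding addition_chain_def by (metis atLeastAtMost_iff)
  then show ?thesis using that[of i s] that[of s i] by (cases "i \<le> s") auto
qed

lemma a_le_double:
  assumes "1 \<le> j" "j \<le> k"
  shows "a j \<le> 2 * a (j - 1)"
proof -
  obtain s i where "i \<le> s" "s < j" "a j = a s + a i" using a_summands assms by blast
  moreover have "a s \<le> a (j - 1)" "a i \<le> a (j - 1)"
    using calculation assms by (auto intro!: a_le)
  ultimately show ?thesis by simp
qed

definition nondoublings :: "nat set" where
  "nondoublings = {j \<in> {1..k}. a j \<noteq> 2 * a (j - 1)}"

lemma finite_nondoublings: "finite nondoublings"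
  by (simp add: nondoublings_def)

lemma nondoublings_iff: "j \<in> nondoublings \<longleftrightarrow> 1 \<le> j \<and> j \<le> k \<and> a j \<noteq> 2 * a (j - 1)"
  by (auto simp: nondoublings_def)

text \<open>At a non-doubling the smaller summand can be required to have index at most
  \<open>j - 2\<close>: index \<open>j - 1\<close> would force both summands to be
  \<open>a (j - 1)\<close>.\<close>

definition summands :: "nat \<Rightarrow> nat \<times> nat" where
  "summands j = (SOME (s, i). i \<le> s \<and> s < j \<and> Suc i < j \<and> a j = a s + a i)"

abbreviation "larger j \<equiv> fst (summands j)"
abbreviation "smaller j \<equiv> snd (summands j)"

lemma summands:
  assumes "j \<in> nondoublings"
  shows "smaller j \<le> larger j" "larger j < j" "Suc (smaller j) < j"
    "a j = a (larger j) + a (smaller j)"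
proof -
  have j: "1 \<le> j" "j \<le> k" "a j \<noteq> 2 * a (j - 1)" using assms by (auto simp: nondoublings_iff)
  obtain s i where si: "i \<le> s" "s < j" "a j = a s + a i" using a_summands j by blast
  have "Suc i < j"
  proof (rule ccontr)
    assume "\<not> Suc i < j"
    then have "i = j - 1" "s = j - 1" using si by auto
    then show False using si j by simp
  qed
  then have "case summands j of (s, i) \<Rightarrow> i \<le> s \<and> s < j \<and> Suc i < j \<and> a j = a s + a i"
    unfolding summands_def using si
    by (intro someI[where P = "\<lambda>(s, i). i \<le> s \<and> s < j \<and> Suc i < j \<and> a j = a s + a i" and x = "(s, i)"]) auto
  then show "smaller j \<le> larger j" "larger j < j" "Suc (smaller j) < j"
    "a j = a (larger j) + a (smaller j)"
    by (auto simp: case_prod_beta)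
qed

text \<open>A doubling at \<open>h\<close> would give
  \<open>a h \<ge> 2 * a (larger j) \<ge> a j\<close>, although the chain increases.\<close>

lemma between_larger_nondoubling:
  assumes "j \<in> nondoublings" "larger j < h" "h < j"
  shows "h \<in> nondoublings"
proof (rule ccontr)
  assume "h \<notin> nondoublings"
  moreover have jk: "j \<le> k" using assms by (simp add: nondoublings_iff)
  ultimately have "a h = 2 * a (h - 1)" using assms by (auto simp: nondoublings_iff)
  moreover have "a (larger j) \<le> a (h - 1)" "a h < a j" "a (smaller j) \<le> a (larger j)"
    using assms jk summands(1,2)[OF assms(1)] by (auto intro!: a_le a_less)
  ultimately show False using summands(4)[OF assms(1)] by linarith
qed

text \<open>A doubling at \<open>h\<close> would force
  \<open>a (smaller j) \<le> a (j - 1) / 2\<close>, hence a ratio of at most 3/2.\<close>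

lemma between_smaller_nondoubling:
  assumes "j \<in> nondoublings" "2 * a j > 3 * a (j - 1)" "smaller j < h" "h < j"
  shows "h \<in> nondoublings"
proof (rule ccontr)
  assume "h \<notin> nondoublings"
  moreover have jk: "j \<le> k" using assms by (simp add: nondoublings_iff)
  ultimately have "a h = 2 * a (h - 1)" using assms by (auto simp: nondoublings_iff)
  moreover have "a (smaller j) \<le> a (h - 1)" "a h \<le> a (j - 1)" "a (larger j) \<le> a (j - 1)"
    using assms jk summands[OF assms(1)] by (auto intro!: a_le)
  ultimately show False using summands(4)[OF assms(1)] assms(2) by linarith
qed

text \<open>The shortfall from doubling on the binary logarithmic scale; it telescopes along the
  chain.\<close>

definition loss :: "nat \<Rightarrow> real" where
  "loss j = 1 - log 2 (real (a j) / real (a (j - 1)))"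

lemma loss_ge:
  assumes "1 \<le> j" "j \<le> k" "real (a j) \<le> x * real (a (j - 1))"
  shows "loss j \<ge> 1 - log 2 x"
proof -
  have p: "real (a j) > 0" "real (a (j - 1)) > 0"
    using a_pos[of j] a_pos[of "j - 1"] assms by (simp_all add: Suc_le_eq)
  then have "real (a j) / real (a (j - 1)) \<le> x" using assms by (simp add: field_simps)
  moreover have "0 < real (a j) / real (a (j - 1))" using p by simp
  ultimately show ?thesis by (simp add: loss_def)
qed

lemma loss_nonneg:
  assumes "1 \<le> j" "j \<le> k"
  shows "loss j \<ge> 0"
proof -
  have "real (a j) \<le> 2 * real (a (j - 1))" using a_le_double[OF assms] by linarith
  then show ?thesis using loss_ge[OF assms] by fastforce
qed

lemma sum_loss: "(\<Sum>j=1..k. loss j) = real k - log 2 (real (a k))"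
proof -
  have "(\<Sum>j=1..i. loss j) = real i - log 2 (real (a i))" if "i \<le> k" for i
    using that
  proof (induction i)
    case 0
    then show ?case by (simp add: a_0)
  next
    case (Suc i)
    have "real (a i) > 0" "real (a (Suc i)) > 0"
      using a_pos[of i] a_pos[of "Suc i"] Suc.prems by auto
    then show ?case using Suc by (simp add: loss_def log_divide)
  qed
  then show ?thesis by simp
qed

lemma sum_loss_subset_le:
  assumes "A \<subseteq> {1..k}"
  shows "sum loss A \<le> real k - log 2 (real (a k))"
  unfolding sum_loss[symmetric] using assms by (intro sum_mono2) (auto intro: loss_nonneg)

text \<open>A single non-doubling may lose very little, but
  \<open>a j \<le> a (j - 1) + a (j - 2) \<le> 3 * a (j - 2)\<close>, so together with the preceding
  step it loses at least \<open>2 - log 2 3\<close>.\<close>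

lemma loss_pair:
  assumes "j \<in> nondoublings"
  shows "2 \<le> j" "loss j + loss (j - 1) \<ge> 2 / 5"
proof -
  note s = summands[OF assms]
  have jk: "j \<le> k" using assms by (simp add: nondoublings_iff)
  show j: "2 \<le> j" using s(3) by simp
  have "a (larger j) \<le> a (j - 1)" "a (smaller j) \<le> a (j - 2)"
    using s j jk by (auto intro!: a_le)
  moreover have "a (j - 1) \<le> 2 * a (j - 2)"
    using a_le_double[of "j - 1"] j jk by (auto simp: numeral_2_eq_2)
  ultimately have "a j \<le> 3 * a (j - 2)" using s(4) by linarith
  then have 3: "real (a j) \<le> 3 * real (a (j - 2))" by linarith
  have p: "real (a j) > 0" "real (a (j - 1)) > 0" "real (a (j - 2)) > 0"
    using a_pos[of j] a_pos[of "j - 1"] a_pos[of "j - 2"] jk by (simp_all add: Suc_le_eq)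
  have "log 2 (real (a j)) \<le> log 2 (3 * real (a (j - 2)))"
    using 3 p by simp
  also have "\<dots> = 1 + log 2 (3 / 2) + log 2 (real (a (j - 2)))"
    using p by (simp add: log_mult log_divide)
  finally show "loss j + loss (j - 1) \<ge> 2 / 5"
    using p log2_three_halves_le j unfolding loss_def
    by (simp add: log_divide numeral_2_eq_2 diff_diff_left)
qed

text \<open>Every step lies in at most two of the pairs of \<open>loss_pair\<close>, so
  \<open>2 / 5\<close> per non-doubling sums to at most twice the total loss.\<close>

lemma card_nondoublings_le: "real (card nondoublings) \<le> 5 * (real k - log 2 (real (a k)))"
proof -
  have sub: "nondoublings \<subseteq> {1..k}" "(\<lambda>j. j - 1) ` nondoublings \<subseteq> {1..k}"
    using loss_pair(1) by (fastforce simp: nondoublings_iff)+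
  have inj: "inj_on (\<lambda>j. j - 1) nondoublings"
    using loss_pair(1) by (fastforce simp: inj_on_def)
  have "real (card nondoublings) * (2 / 5) \<le> (\<Sum>j\<in>nondoublings. loss j + loss (j - 1))"
    using loss_pair(2) by (intro sum_bounded_below) auto
  also have "\<dots> = sum loss nondoublings + sum loss ((\<lambda>j. j - 1) ` nondoublings)"
    by (simp add: sum.distrib sum.reindex[OF inj] o_def del: One_nat_def)
  also have "\<dots> \<le> 2 * (real k - log 2 (real (a k)))"
    using sum_loss_subset_le[OF sub(1)] sum_loss_subset_le[OF sub(2)] by simp
  finally show ?thesis by simp
qed

text \<open>Each step in \<open>A\<close> gains at least \<open>\<eta> * a h\<close>, so linear
  growth from \<open>a h\<close> already exceeds \<open>X * a h\<close> if \<open>A\<close> is too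
  large.\<close>

lemma card_window_le:
  fixes \<eta> X :: real
  assumes "\<eta> > 0" "X \<ge> 1" and A: "A \<subseteq> {1..k}"
    and ratio: "\<And>j. j \<in> A \<Longrightarrow> real (a j) \<ge> (1 + \<eta>) * real (a (j - 1))"
    and h: "\<And>j. j \<in> A \<Longrightarrow> h < j \<and> real (a (j - 1)) \<le> X * real (a h)"
  shows "real (card A) \<le> 1 + (X - 1) / \<eta>"
proof (cases "A = {}")
  case True
  then show ?thesis using assms by simp
next
  case False
  have finA: "finite A" using A finite_subset by blast
  have growth: "real (a x) \<ge> (1 + \<eta> * real (card (A \<inter> {..x}))) * real (a h)" if "h \<le> x" "x \<le> k" for x
    using that
  proof (induction x rule: dec_induct)
    case base
    have "A \<inter> {..h} = {}" using h by force
    then show ?case by simp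
  next
    case (step x)
    have ah: "real (a h) \<le> real (a x)" "real (a x) \<le> real (a (Suc x))"
      using step a_le by auto
    show ?case
    proof (cases "Suc x \<in> A")
      case True
      have "A \<inter> {..Suc x} = insert (Suc x) (A \<inter> {..x})" using True by (auto simp: le_Suc_eq)
      then have "card (A \<inter> {..Suc x}) = Suc (card (A \<inter> {..x}))" by simp
      then have "(1 + \<eta> * real (card (A \<inter> {..Suc x}))) * real (a h)
          = (1 + \<eta> * real (card (A \<inter> {..x}))) * real (a h) + \<eta> * real (a h)"
        by (simp add: algebra_simps)
      also have "\<dots> \<le> real (a x) + \<eta> * real (a x)"
        using step ah assms by (intro add_mono mult_left_mono) auto
      also have "\<dots> \<le> real (a (Suc x))" using ratio[OF True] by (simp add: algebra_simps)
      finally show ?thesis .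
    next
      case False
      then have "A \<inter> {..Suc x} = A \<inter> {..x}" by (auto simp: le_Suc_eq)
      then show ?thesis using step ah by simp
    qed
  qed
  define M where "M = Max A"
  have M: "M \<in> A" unfolding M_def using False finA by simp
  then have Mk: "1 \<le> M" "M \<le> k" "h < M" using A h by auto
  \<comment> \<open>The assumption bounds \<open>a (M - 1)\<close>, not \<open>a M\<close>, so the
    last step of \<open>A\<close> is left out; this is the summand 1 in the conclusion.\<close>
  have "A \<inter> {..M - 1} = A - {M}"
    using Mk Max_ge[OF finA] unfolding M_def[symmetric] by force
  then have c: "real (card (A \<inter> {..M - 1})) = real (card A) - 1"
    using M finA card_gt_0_iff[of A] False by (simp add: of_nat_diff Suc_leI)
  have "(1 + \<eta> * (real (card A) - 1)) * real (a h) \<le> X * real (a h)"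
    using growth[of "M - 1"] Mk h[OF M] unfolding c by linarith
  moreover have "real (a h) > 0" using a_pos[of h] Mk by simp
  ultimately have "1 + \<eta> * (real (card A) - 1) \<le> X" by simp
  then show ?thesis using assms by (simp add: field_simps)
qed

end

section \<open>Tiny, medium and big steps\<close>

locale chain_param = chain +
  fixes B :: nat
  assumes B: "B \<ge> 2"
begin

definition tiny_steps :: "nat set" where
  "tiny_steps = {j \<in> nondoublings. real (a j) \<le> (1 + 1 / B) * real (a (j - 1))}"

definition big_steps :: "nat set" where
  "big_steps = {j \<in> nondoublings. 2 * a j > 3 * a (j - 1)}"

definition medium_steps :: "nat set" where
  "medium_steps = nondoublings - tiny_steps - big_steps"

text \<open>Growth by at most \<open>1 + 1 / B\<close> loses at least \<open>1 - 2 / B\<close>, and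
  growth by at most 3/2 loses at least \<open>2 / 5\<close>. This budget is later balanced against
  the coding costs of tiny and medium steps.\<close>

lemma weighted_steps_le:
  "(1 - 2 / real B) * real (card tiny_steps) + 2 / 5 * real (card medium_steps)
     \<le> real k - log 2 (real (a k))"
proof -
  have "loss j \<ge> 1 - 2 / real B" if "j \<in> tiny_steps" for j
  proof -
    have "loss j \<ge> 1 - log 2 (1 + 1 / B)"
      using that by (intro loss_ge) (auto simp: tiny_steps_def nondoublings_iff)
    then show ?thesis using log2_one_plus_le[of "1 / B"] by simp
  qed
  then have 1: "real (card tiny_steps) * (1 - 2 / real B) \<le> sum loss tiny_steps"
    by (intro sum_bounded_below) auto
  have "loss j \<ge> 2 / 5" if "j \<in> medium_steps" for j
  proof -
    have "loss j \<ge> 1 - log 2 (3 / 2)"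
      using that by (intro loss_ge) (auto simp: medium_steps_def big_steps_def nondoublings_iff)
    then show ?thesis using log2_three_halves_le by simp
  qed
  then have 2: "real (card medium_steps) * (2 / 5) \<le> sum loss medium_steps"
    by (intro sum_bounded_below) auto
  have "sum loss tiny_steps + sum loss medium_steps = sum loss (tiny_steps \<union> medium_steps)"
    by (rule sum.union_disjoint[symmetric])
      (auto simp: tiny_steps_def medium_steps_def intro: finite_subset[OF _ finite_nondoublings])
  also have "\<dots> \<le> real k - log 2 (real (a k))"
    by (rule sum_loss_subset_le) (auto simp: tiny_steps_def medium_steps_def nondoublings_iff)
  finally show ?thesis using 1 2 by (simp add: mult.commute)
qed

text \<open>Sum over the points \<open>h\<close> the number of intervals from
  \<open>smaller j\<close> to \<open>j\<close> that contain \<open>h\<close>. A ratio above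
  \<open>1 + 1 / B\<close> forces \<open>a (smaller j) \<ge> a (j - 1) / B\<close>, so the window
  bound applies with \<open>\<eta> = 1 / B\<close> and \<open>X = B\<close>.\<close>

lemma sum_medium_offsets_le: "(\<Sum>j\<in>medium_steps. j - smaller j) \<le> k * (1 + B ^ 2)"
proof -
  have J: "j \<in> nondoublings" "real (a j) \<ge> (1 + 1 / B) * real (a (j - 1))" if "j \<in> medium_steps" for j
    using that by (auto simp: medium_steps_def tiny_steps_def)
  have jk: "1 \<le> j" "j \<le> k" if "j \<in> medium_steps" for j
    using J(1)[OF that] by (auto simp: nondoublings_iff)
  have fin: "finite medium_steps" using finite_nondoublings by (simp add: medium_steps_def)
  have offset: "j - smaller j = card {h \<in> {0..<k}. smaller j \<le> h \<and> h < j}" if "j \<in> medium_steps" for j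
  proof -
    have "{h \<in> {0..<k}. smaller j \<le> h \<and> h < j} = {smaller j..<j}" using jk[OF that] by auto
    then show ?thesis by simp
  qed
  have "(\<Sum>j\<in>medium_steps. j - smaller j)
      = (\<Sum>j\<in>medium_steps. card {h \<in> {0..<k}. smaller j \<le> h \<and> h < j})"
    by (rule sum.cong[OF refl offset])
  also have "\<dots> = (\<Sum>h\<in>{0..<k}. card {j \<in> medium_steps. smaller j \<le> h \<and> h < j})"
    using fin by (intro sum_card_swap) auto
  also have "\<dots> \<le> (\<Sum>h\<in>{0..<k}. 1 + B ^ 2)"
  proof (rule sum_mono)
    fix h assume h: "h \<in> {0..<k}"
    have "real (card {j \<in> medium_steps. smaller j \<le> h \<and> h < j}) \<le> 1 + (real B - 1) / (1 / B)"
    proof (rule card_window_le)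
      fix j assume j: "j \<in> {j \<in> medium_steps. smaller j \<le> h \<and> h < j}"
      then have j': "j \<in> medium_steps" by simp
      show "real (a j) \<ge> (1 + 1 / B) * real (a (j - 1))" using J j' by simp
      have "a (larger j) \<le> a (j - 1)" "a (smaller j) \<le> a h"
        using summands[OF J(1)[OF j']] jk[OF j'] j by (auto intro!: a_le)
      then have "real (a (j - 1)) / B \<le> real (a h)"
        using J(2)[OF j'] summands(4)[OF J(1)[OF j']] by (simp add: algebra_simps)
      then show "h < j \<and> real (a (j - 1)) \<le> real B * real (a h)"
        using j B by (simp add: field_simps)
    qed (use B jk in auto)
    also have "\<dots> \<le> real (1 + B ^ 2)" using B by (simp add: power2_eq_square algebra_simps)
    finally show "card {j \<in> medium_steps. smaller j \<le> h \<and> h < j} \<le> 1 + B ^ 2"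
      by (simp only: of_nat_le_iff)
  qed
  finally show ?thesis by simp
qed

text \<open>The same double count, now only over non-doublings, since no doubling separates a big
  step from its smaller summand. The window bound with \<open>\<eta> = 1 / 2\<close> and
  \<open>X = 2\<close> gives 3.\<close>

lemma sum_big_offsets_le: "(\<Sum>j\<in>big_steps. j - Suc (smaller j)) \<le> 3 * card nondoublings"
proof -
  have J: "j \<in> nondoublings" "2 * a j > 3 * a (j - 1)" if "j \<in> big_steps" for j
    using that by (auto simp: big_steps_def)
  have jk: "1 \<le> j" "j \<le> k" if "j \<in> big_steps" for j
    using J(1)[OF that] by (auto simp: nondoublings_iff)
  have fin: "finite big_steps" using finite_nondoublings by (simp add: big_steps_def)
  have offset: "j - Suc (smaller j) = card {h \<in> nondoublings. smaller j < h \<and> h < j}" if "j \<in> big_steps" for j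
  proof -
    have "{h \<in> nondoublings. smaller j < h \<and> h < j} = {smaller j<..<j}"
      using between_smaller_nondoubling[OF J[OF that]] by auto
    then show ?thesis by simp
  qed
  have "(\<Sum>j\<in>big_steps. j - Suc (smaller j))
      = (\<Sum>j\<in>big_steps. card {h \<in> nondoublings. smaller j < h \<and> h < j})"
    by (rule sum.cong[OF refl offset])
  also have "\<dots> = (\<Sum>h\<in>nondoublings. card {j \<in> big_steps. smaller j < h \<and> h < j})"
    using fin finite_nondoublings by (intro sum_card_swap) auto
  also have "\<dots> \<le> (\<Sum>h\<in>nondoublings. 3)"
  proof (rule sum_mono)
    fix h assume h: "h \<in> nondoublings"
    have "real (card {j \<in> big_steps. smaller j < h \<and> h < j}) \<le> 1 + (2 - 1) / (1 / 2)"
    proof (rule card_window_le)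
      fix j assume j: "j \<in> {j \<in> big_steps. smaller j < h \<and> h < j}"
      then have j': "j \<in> big_steps" by simp
      show "real (a j) \<ge> (1 + 1 / 2) * real (a (j - 1))" using J(2)[OF j'] by simp
      have "a (larger j) \<le> a (j - 1)" "a (smaller j) \<le> a h"
        using summands[OF J(1)[OF j']] jk[OF j'] j by (auto intro!: a_le)
      then have "a (j - 1) \<le> 2 * a h"
        using J(2)[OF j'] summands(4)[OF J(1)[OF j']] by linarith
      then show "h < j \<and> real (a (j - 1)) \<le> 2 * real (a h)"
        using j by simp
    qed (use jk in auto)
    then show "card {j \<in> big_steps. smaller j < h \<and> h < j} \<le> 3" by simp
  qed
  finally show ?thesis by (simp add: mult.commute)
qed

end

section \<open>Compressing an addition chain\<close>

context chain_param
begin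

abbreviation "node_count \<equiv> card nondoublings"

text \<open>Position 0 is added as node 0, which carries the starting value 1.\<close>

definition pos :: "nat \<Rightarrow> nat" where
  "pos = enumerate (insert 0 nondoublings)"

lemma card_insert_nondoublings: "card (insert 0 nondoublings) = Suc node_count"
proof -
  have "0 \<notin> nondoublings" by (simp add: nondoublings_iff)
  then show ?thesis using finite_nondoublings by simp
qed

lemma pos_0: "pos 0 = 0"
  by (simp add: pos_def enumerate_0)

lemma pos_less: "i < j \<Longrightarrow> j \<le> node_count \<Longrightarrow> pos i < pos j"
  unfolding pos_def using finite_nondoublings card_insert_nondoublings
  by (intro finite_enumerate_mono) auto

lemma pos_le: "i \<le> j \<Longrightarrow> j \<le> node_count \<Longrightarrow> pos i \<le> pos j"
  using pos_less[of i j] by (cases "i = j") auto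

lemma pos_less_iff: "i \<le> node_count \<Longrightarrow> j \<le> node_count \<Longrightarrow> pos i < pos j \<longleftrightarrow> i < j"
  by (meson leD leI pos_le pos_less)

lemma pos_nondoubling:
  assumes "l \<in> {1..node_count}"
  shows "pos l \<in> nondoublings" "1 \<le> pos l" "pos l \<le> k"
proof -
  have "pos l \<in> insert 0 nondoublings"
    unfolding pos_def using finite_nondoublings card_insert_nondoublings assms
    by (intro finite_enumerate_in_set) auto
  moreover have "0 < pos l" using pos_less[of 0 l] assms by (simp add: pos_0)
  ultimately show "pos l \<in> nondoublings" "1 \<le> pos l" "pos l \<le> k"
    by (auto simp: nondoublings_iff)
qed

lemma pos_le_length: "l \<le> node_count \<Longrightarrow> pos l \<le> k"
  using pos_nondoubling(3)[of l] by (cases "l = 0") (auto simp: pos_0)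

lemma nondoubling_pos:
  assumes "j \<in> nondoublings"
  obtains l where "l \<in> {1..node_count}" "pos l = j"
proof -
  obtain l where "l < Suc node_count" "pos l = j"
    using finite_enumerate_Ex[of "insert 0 nondoublings" j] assms finite_nondoublings
      card_insert_nondoublings unfolding pos_def by auto
  moreover have "l \<noteq> 0"
    using assms calculation pos_0 by (metis nondoublings_iff not_one_le_zero)
  ultimately show ?thesis using that[of l] by auto
qed

lemma bij_betw_pos: "bij_betw pos {1..node_count} nondoublings"
  unfolding bij_betw_def
proof
  show "inj_on pos {1..node_count}"
    by (rule linorder_inj_onI) (use pos_less in force)+
  show "pos ` {1..node_count} = nondoublings"
  proof
    show "nondoublings \<subseteq> pos ` {1..node_count}"
      by (rule subsetI, erule nondoubling_pos) auto
  qed (use pos_nondoubling(1) in blast)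
qed

lemma pos_diff: "i \<le> j \<Longrightarrow> j \<le> node_count \<Longrightarrow> pos i + (j - i) \<le> pos j"
proof (induction j rule: dec_induct)
  case (step j)
  then show ?case using pos_less[of j "Suc j"] by simp
qed simp

text \<open>Everything between the two positions is a node, so the interval has no more elements
  than \<open>{i..j}\<close>; \<open>pos_diff\<close> is the reverse inequality.\<close>

lemma pos_consecutive:
  assumes "1 \<le> i" "i \<le> j" "j \<le> node_count"
    and "\<And>h. pos i < h \<Longrightarrow> h < pos j \<Longrightarrow> h \<in> nondoublings"
  shows "pos j = pos i + (j - i)"
proof -
  have "{pos i..pos j} \<subseteq> pos ` {i..j}"
  proof
    fix h assume h: "h \<in> {pos i..pos j}"
    then have "h \<in> nondoublings"
      using assms pos_nondoubling(1)[of i] pos_nondoubling(1)[of j]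
      by (cases "h = pos i"; cases "h = pos j") auto
    then obtain l where l: "l \<in> {1..node_count}" "pos l = h" by (rule nondoubling_pos)
    then have "i \<le> l" "l \<le> j"
      using h assms pos_less[of l i] pos_less[of j l] by force+
    then show "h \<in> pos ` {i..j}" using l by auto
  qed
  then have "card {pos i..pos j} \<le> card {i..j}"
    by (meson card_image_le card_mono dual_order.trans finite_atLeastAtMost finite_imageI)
  then have "pos j \<le> pos i + (j - i)" using assms(2) by simp
  then show ?thesis using pos_diff[of i j] assms by simp
qed

lemma a_doublings:
  assumes "x \<le> y" "y \<le> k" "\<And>h. x < h \<Longrightarrow> h \<le> y \<Longrightarrow> h \<notin> nondoublings"
  shows "a y = 2 ^ (y - x) * a x"
  using assms
proof (induction y rule: dec_induct)
  case (step y)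
  then have "Suc y \<notin> nondoublings" by auto
  then have "a (Suc y) = 2 * a y" using step by (simp add: nondoublings_iff)
  then show ?case using step by (simp add: Suc_diff_le)
qed simp

text \<open>\<open>shift l\<close> counts the doublings before node \<open>l\<close>. Multiplying node \<open>l\<close> by \<open>2 ^ padding l\<close>
  rounds this number up to a multiple of \<open>B\<close>; nodes not separated by a doubling get the same
  padding, so sums within a run of non-doublings survive the scaling.\<close>

definition shift :: "nat \<Rightarrow> nat" where
  "shift l = pos l - l"

definition rounded :: "nat \<Rightarrow> nat" where
  "rounded l = (shift l + (B - 1)) div B"

definition padding :: "nat \<Rightarrow> nat" where
  "padding l = B * rounded l - shift l"

definition gap :: "nat \<Rightarrow> nat" where
  "gap l = rounded l - rounded (l - 1)"

definition val :: "nat \<Rightarrow> real" where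
  "val l = 2 ^ padding l * real (a (pos l))"

text \<open>Makes the natural subtraction in \<open>shift\<close> exact.\<close>

lemma le_pos: "l \<le> node_count \<Longrightarrow> l \<le> pos l"
  using pos_diff[of 0 l] by (simp add: pos_0)

lemma padding: "shift l + padding l = B * rounded l" "padding l < B"
proof -
  have "(shift l + (B - 1)) mod B < B" using B by simp
  moreover have "B * rounded l + (shift l + (B - 1)) mod B = shift l + (B - 1)"
    unfolding rounded_def by simp
  ultimately show "shift l + padding l = B * rounded l" "padding l < B"
    unfolding padding_def using B by linarith+
qed

lemma shift_mono:
  assumes "i \<le> j" "j \<le> node_count"
  shows "shift i \<le> shift j"
proof -
  have "pos i + (j - i) \<le> pos j" "i \<le> pos i" using pos_diff le_pos assms by auto
  then show ?thesis using assms(1) unfolding shift_def by linarith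
qed

lemma gap:
  assumes "l \<in> {1..node_count}"
  shows "rounded (l - 1) + gap l = rounded l"
proof -
  have "rounded (l - 1) \<le> rounded l"
    unfolding rounded_def using assms by (intro div_le_mono add_right_mono shift_mono) auto
  then show ?thesis by (simp add: gap_def)
qed

lemma sum_gap_le: "sum gap {1..node_count} \<le> k div B + 1"
proof -
  \<comment> \<open>The gaps telescope, so their total is only about \<open>k / B\<close>.\<close>
  have "sum gap {1..l} = rounded l" if "l \<le> node_count" for l
    using that
  proof (induction l)
    case 0
    then show ?case using B by (simp add: rounded_def shift_def pos_0)
  next
    case (Suc l)
    then show ?case using gap[of "Suc l"] by simp
  qed
  then have "sum gap {1..node_count} = rounded node_count" by simp
  also have "\<dots> \<le> (k + B) div B"
    unfolding rounded_def shift_def using pos_le_length[of node_count] by (intro div_le_mono) auto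
  also have "\<dots> = k div B + 1" using B by simp
  finally show ?thesis .
qed

text \<open>The steps strictly between consecutive nodes are doublings,
  \<open>shift l - shift (l - 1)\<close> in number. As \<open>shift + padding\<close> is
  \<open>B * rounded\<close> at both nodes, the rounded gap is exactly compensated by the change of
  padding.\<close>

lemma base_val:
  assumes "l \<in> {1..node_count}"
  shows "base B gap val l = 2 ^ padding l * real (a (pos l - 1))"
proof -
  have lt: "pos (l - 1) < pos l" using pos_less[of "l - 1" l] assms by simp
  have "h \<notin> nondoublings" if "pos (l - 1) < h" "h \<le> pos l - 1" for h
  proof
    assume "h \<in> nondoublings"
    then obtain x where x: "x \<in> {1..node_count}" "pos x = h" by (rule nondoubling_pos)
    have "l - 1 < x" using pos_less_iff[of "l - 1" x] x that assms by (simp add: le_diff_conv)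
    moreover have "x < l" using pos_less_iff[of x l] x that lt assms by auto
    ultimately show False by simp
  qed
  then have "a (pos l - 1) = 2 ^ (pos l - 1 - pos (l - 1)) * a (pos (l - 1))"
    using lt pos_le_length[of l] assms by (intro a_doublings) auto
  moreover have "B * gap l + padding (l - 1) = padding l + (pos l - 1 - pos (l - 1))"
  proof -
    have "B * rounded (l - 1) + B * gap l = B * rounded l"
      using gap[OF assms] by (metis add_mult_distrib2)
    moreover have "shift (l - 1) + (pos l - 1 - pos (l - 1)) = shift l"
    proof -
      have "l - 1 \<le> pos (l - 1)" "l \<le> pos l" using le_pos[of "l - 1"] le_pos[of l] assms by auto
      then show ?thesis unfolding shift_def using lt assms by auto
    qed
    ultimately show ?thesis using padding(1)[of l] padding(1)[of "l - 1"] by linarith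
  qed
  ultimately have "2 ^ (B * gap l + padding (l - 1)) * real (a (pos (l - 1)))
      = 2 ^ padding l * real (a (pos l - 1))"
    by (simp add: power_add)
  then show ?thesis
    by (simp add: base_def val_def power_add mult.assoc)
qed

section \<open>Locating a summand through the first node after it\<close>

definition next_node :: "nat \<Rightarrow> nat" where
  "next_node i = (LEAST x. i < pos x)"

text \<open>Indices beyond \<open>node_count\<close> carry no information; the witness
  \<open>l\<close> keeps the least index within range.\<close>

lemma next_node:
  assumes "l \<in> {1..node_count}" "i < pos l"
  shows "i < pos (next_node i)" "next_node i \<in> {1..l}" "next_node i \<in> {1..node_count}"
    "pos (next_node i - 1) \<le> i"
proof -
  show lt: "i < pos (next_node i)" unfolding next_node_def using assms(2) by (rule LeastI)
  have le: "next_node i \<le> l" unfolding next_node_def using assms(2) by (rule Least_le)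
  have "next_node i \<noteq> 0" using lt pos_0 by (metis not_less_zero)
  then show "next_node i \<in> {1..l}" "next_node i \<in> {1..node_count}" using le assms by auto
  have "\<not> i < pos (next_node i - 1)"
    using \<open>next_node i \<noteq> 0\<close> unfolding next_node_def by (intro not_less_Least) auto
  then show "pos (next_node i - 1) \<le> i" by simp
qed

lemma pos_next_node:
  assumes "Suc i \<in> nondoublings"
  shows "pos (next_node i) = Suc i"
proof -
  obtain x where x: "x \<in> {1..node_count}" "pos x = Suc i" using assms by (rule nondoubling_pos)
  then have "i < pos x" by simp
  have "i < pos (next_node i)" "next_node i \<le> x"
    unfolding next_node_def using \<open>i < pos x\<close> by (auto intro: LeastI Least_le)
  then show ?thesis using pos_le[of "next_node i" x] x by simp
qed

lemma next_node_diff: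
  assumes "l \<in> {1..node_count}" "i < pos l"
  shows "l - next_node i \<le> pos l - Suc i"
proof -
  have "pos (next_node i) + (l - next_node i) \<le> pos l"
    using next_node(2)[OF assms] assms(1) by (intro pos_diff) auto
  then show ?thesis using next_node(1)[OF assms] by linarith
qed

text \<open>Consecutive non-doublings have equal \<open>shift\<close>, hence equal padding. This
  applies to every larger summand and, at big steps, to the smaller one.\<close>

lemma adjacent_node:
  assumes "l \<in> {1..node_count}" "i < pos l" "\<And>h. i < h \<Longrightarrow> h < pos l \<Longrightarrow> h \<in> nondoublings"
  shows "pos (next_node i) = Suc i" "padding (next_node i) = padding l"
    "l - next_node i = pos l - Suc i"
proof -
  let ?x = "next_node i"
  note x = next_node[OF assms(1,2)]
  have "Suc i \<in> nondoublings"
    using assms pos_nondoubling(1)[OF assms(1)] by (cases "Suc i = pos l") auto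
  then show p: "pos ?x = Suc i" by (rule pos_next_node)
  have "pos l = pos ?x + (l - ?x)"
    using x assms p by (intro pos_consecutive) auto
  moreover have "?x \<le> pos ?x" using le_pos[of ?x] x by simp
  ultimately have "shift l = shift ?x" unfolding shift_def using x by simp
  then show "padding ?x = padding l" by (simp add: padding_def rounded_def)
  show "l - ?x = pos l - Suc i" using \<open>pos l = pos ?x + (l - ?x)\<close> p by simp
qed

definition first_ref :: "nat \<Rightarrow> nat" where
  "first_ref l = next_node (larger (pos l))"

definition second_ref :: "nat \<Rightarrow> nat" where
  "second_ref l = next_node (smaller (pos l))"

text \<open>The base of the second reference is \<open>a (smaller (pos l))\<close> doubled as often
  as the positions and its padding say; node \<open>l\<close> wants it scaled by
  \<open>2 ^ padding l\<close>. The added \<open>B\<close> exceeds \<open>padding l\<close>, so the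
  subtraction is exact.\<close>

definition exponent :: "nat \<Rightarrow> nat" where
  "exponent l = B + padding (second_ref l) + (pos (second_ref l) - Suc (smaller (pos l))) - padding l"

lemma node_summands:
  assumes "l \<in> {1..node_count}"
  shows "larger (pos l) < pos l" "smaller (pos l) < pos l" "smaller (pos l) \<le> larger (pos l)"
    "a (pos l) = a (larger (pos l)) + a (smaller (pos l))"
proof -
  note s = summands[OF pos_nondoubling(1)[OF assms]]
  show "larger (pos l) < pos l" "smaller (pos l) \<le> larger (pos l)"
    "a (pos l) = a (larger (pos l)) + a (smaller (pos l))"
    by (rule s)+
  show "smaller (pos l) < pos l" using s(3) by linarith
qed

lemma first_ref:
  assumes "l \<in> {1..node_count}"
  shows "first_ref l \<in> {1..l}" "l - first_ref l = pos l - Suc (larger (pos l))"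
    "base B gap val (first_ref l) = 2 ^ padding l * real (a (larger (pos l)))"
proof -
  note s = node_summands[OF assms]
  note adj = adjacent_node[OF assms s(1) between_larger_nondoubling[OF pos_nondoubling(1)[OF assms]]]
  show "first_ref l \<in> {1..l}"
    using next_node(2)[OF assms s(1)] by (simp add: first_ref_def)
  show "l - first_ref l = pos l - Suc (larger (pos l))"
    using adj(3) by (simp add: first_ref_def)
  show "base B gap val (first_ref l) = 2 ^ padding l * real (a (larger (pos l)))"
    using base_val[OF next_node(3)[OF assms s(1)]] adj(1,2) by (simp add: first_ref_def)
qed

lemma second_ref:
  assumes "l \<in> {1..node_count}"
  shows "second_ref l \<in> {1..l}" "l - second_ref l \<le> pos l - Suc (smaller (pos l))"
    "exponent l < 2 * B + B * gap (second_ref l)"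
    "exponent l \<le> 2 * B + (pos l - smaller (pos l))"
    "base B gap val (second_ref l) * 2 ^ B / 2 ^ exponent l
       = 2 ^ padding l * real (a (smaller (pos l)))"
proof -
  let ?i = "smaller (pos l)" and ?x = "second_ref l"
  note s = node_summands[OF assms]
  note x = next_node[OF assms s(2), folded second_ref_def]
  show "?x \<in> {1..l}" by (rule x(2))
  show "l - ?x \<le> pos l - Suc ?i"
    using next_node_diff[OF assms s(2)] by (simp add: second_ref_def)
  have pl: "padding l < B" "padding ?x < B" by (rule padding)+
  have xl: "pos ?x \<le> pos l" using pos_le[of ?x l] x assms by auto
  show "exponent l \<le> 2 * B + (pos l - ?i)"
    unfolding exponent_def using pl xl by linarith
  have e: "exponent l + padding l = B + padding ?x + (pos ?x - Suc ?i)"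
    unfolding exponent_def using pl by simp
  \<comment> \<open>The doublings from the summand to the node \<open>?x\<close> all lie after node
    \<open>?x - 1\<close>. Rounding then turns their number plus \<open>padding ?x\<close> into at
    most \<open>B * gap ?x + padding (?x - 1)\<close>.\<close>
  have "shift (?x - 1) + (pos ?x - Suc ?i) \<le> shift ?x"
  proof -
    have "?x \<le> node_count" "1 \<le> ?x" using x(3) by auto
    then have "?x - 1 \<le> pos (?x - 1)" "?x \<le> pos ?x" using le_pos[of "?x - 1"] le_pos[of ?x] by auto
    then show ?thesis unfolding shift_def using x(1,4) \<open>1 \<le> ?x\<close> by linarith
  qed
  moreover have "B * rounded (?x - 1) + B * gap ?x = B * rounded ?x"
    using gap[OF x(3)] by (metis add_mult_distrib2)
  ultimately show "exponent l < 2 * B + B * gap ?x"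
    using e padding(1)[of ?x] padding[of "?x - 1"] by linarith
  have "h \<notin> nondoublings" if "?i < h" "h \<le> pos ?x - 1" for h
  proof
    assume "h \<in> nondoublings"
    then obtain y where y: "y \<in> {1..node_count}" "pos y = h" by (rule nondoubling_pos)
    have "?x - 1 < y" using pos_less_iff[of "?x - 1" y] x y that by (simp add: le_diff_conv)
    moreover have "y < ?x" using pos_less_iff[of y ?x] x y that by auto
    ultimately show False by simp
  qed
  then have "a (pos ?x - 1) = 2 ^ (pos ?x - 1 - ?i) * a ?i"
    using x(1) pos_le_length[of ?x] x(3) by (intro a_doublings) auto
  then have "base B gap val ?x = 2 ^ (padding ?x + (pos ?x - Suc ?i)) * real (a ?i)"
    using base_val[OF x(3)] by (simp add: power_add)
  then have "base B gap val ?x * 2 ^ B = 2 ^ (exponent l + padding l) * real (a ?i)"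
    unfolding e by (simp add: power_add mult_ac)
  then show "base B gap val ?x * 2 ^ B / 2 ^ exponent l = 2 ^ padding l * real (a ?i)"
    by (simp add: power_add field_simps)
qed

lemma compressed: "compressed_chain B node_count gap val first_ref second_ref exponent"
  unfolding compressed_chain_def
proof (intro conjI ballI)
  show "val 0 = 1"
    using B by (simp add: val_def pos_0 a_0 padding_def rounded_def shift_def)
next
  fix l assume l: "l \<in> {1..node_count}"
  show "first_ref l \<in> {1..l}" "second_ref l \<in> {1..l}" "exponent l < 2 * B + B * gap (second_ref l)"
    using first_ref[OF l] second_ref[OF l] by blast+
  show "val l = node_val B gap val (first_ref l, second_ref l, exponent l)"
    using first_ref(3)[OF l] second_ref(5)[OF l] node_summands(4)[OF l]
    by (simp add: node_val_def val_def distrib_left)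
  have "a (pos l - 1) < a (pos l)"
    using pos_nondoubling[OF l] by (intro a_less) auto
  then show "base B gap val l < val l"
    using base_val[OF l] by (simp add: val_def)
qed

lemma last_val: "real (a k) * 2 ^ padding node_count = 2 ^ (k - pos node_count) * val node_count"
proof -
  have "h \<notin> nondoublings" if "pos node_count < h" "h \<le> k" for h
  proof
    assume "h \<in> nondoublings"
    then obtain y where "y \<in> {1..node_count}" "pos y = h" by (rule nondoubling_pos)
    then show False using that pos_le[of y node_count] by auto
  qed
  then have "a k = 2 ^ (k - pos node_count) * a (pos node_count)"
    using pos_le_length[of node_count] by (intro a_doublings) auto
  then show ?thesis by (simp add: val_def)
qed

section \<open>Offset sums at medium and big nodes\<close>

definition nodes_at :: "nat set \<Rightarrow> nat set" where
  "nodes_at J = {l \<in> {1..node_count}. pos l \<in> J}"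

lemma bij_betw_nodes_at:
  assumes "J \<subseteq> nondoublings"
  shows "bij_betw pos (nodes_at J) J"
proof -
  have "J \<subseteq> pos ` nodes_at J"
  proof
    fix j assume "j \<in> J"
    then obtain l where "l \<in> {1..node_count}" "pos l = j"
      using assms nondoubling_pos by blast
    then show "j \<in> pos ` nodes_at J" using \<open>j \<in> J\<close> by (auto simp: nodes_at_def)
  qed
  then have "pos ` nodes_at J = J" by (auto simp: nodes_at_def)
  then show ?thesis
    using bij_betw_pos by (auto simp: bij_betw_def nodes_at_def intro: inj_on_subset)
qed

lemma sum_nodes_at:
  assumes "J \<subseteq> nondoublings"
  shows "(\<Sum>l\<in>nodes_at J. f (pos l)) = sum f J"
  using bij_betw_nodes_at[OF assms] by (rule sum.reindex_bij_betw)

lemma card_nodes_at: "J \<subseteq> nondoublings \<Longrightarrow> card (nodes_at J) = card J"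
  using bij_betw_nodes_at by (rule bij_betw_same_card)

lemma medium_sums:
  shows "(\<Sum>l\<in>nodes_at medium_steps. l - first_ref l) \<le> k * (1 + B ^ 2) + 2 * B * node_count" (is ?A)
    and "(\<Sum>l\<in>nodes_at medium_steps. l - second_ref l) \<le> k * (1 + B ^ 2) + 2 * B * node_count" (is ?B)
    and "sum exponent (nodes_at medium_steps) \<le> k * (1 + B ^ 2) + 2 * B * node_count" (is ?C)
proof -
  let ?M = "nodes_at medium_steps"
  have sub: "medium_steps \<subseteq> nondoublings" by (auto simp: medium_steps_def)
  have "(\<Sum>l\<in>?M. pos l - smaller (pos l)) \<le> k * (1 + B ^ 2)"
    using sum_nodes_at[OF sub, of "\<lambda>j. j - smaller j"] sum_medium_offsets_le by simp
  moreover have "card ?M \<le> node_count"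
    using card_nodes_at[OF sub] card_mono[OF finite_nondoublings sub] by simp
  then have "card ?M * (2 * B) \<le> 2 * B * node_count" by simp
  ultimately have bound: "(\<Sum>l\<in>?M. 2 * B + (pos l - smaller (pos l))) \<le> k * (1 + B ^ 2) + 2 * B * node_count"
    unfolding sum.distrib sum_constant of_nat_id by linarith
  have M: "l \<in> {1..node_count}" if "l \<in> ?M" for l using that by (simp add: nodes_at_def)
  have "l - first_ref l \<le> 2 * B + (pos l - smaller (pos l))" if "l \<in> ?M" for l
    using first_ref(2)[OF M[OF that]] node_summands(3)[OF M[OF that]] by simp
  then show ?A by (intro order_trans[OF sum_mono bound])
  have "l - second_ref l \<le> 2 * B + (pos l - smaller (pos l))" if "l \<in> ?M" for l
    using second_ref(2)[OF M[OF that]] by simp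
  then show ?B by (intro order_trans[OF sum_mono bound])
  show ?C by (rule order_trans[OF sum_mono bound]) (rule second_ref(4)[OF M])
qed

text \<open>With only non-doublings between both summands and the step, the paddings agree and the
  exponent carries no information.\<close>

lemma big_node:
  assumes "l \<in> nodes_at big_steps"
  shows "exponent l = B" "l - second_ref l = pos l - Suc (smaller (pos l))"
    "l - first_ref l \<le> pos l - Suc (smaller (pos l))"
proof -
  have l: "l \<in> {1..node_count}" and big: "2 * a (pos l) > 3 * a (pos l - 1)"
    using assms by (auto simp: nodes_at_def big_steps_def)
  note s = node_summands[OF l]
  note adj = adjacent_node[OF l s(2) between_smaller_nondoubling[OF pos_nondoubling(1)[OF l] big],
      folded second_ref_def]
  show "exponent l = B" using adj(1,2) by (simp add: exponent_def)
  show "l - second_ref l = pos l - Suc (smaller (pos l))" by (rule adj(3))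
  show "l - first_ref l \<le> pos l - Suc (smaller (pos l))"
    using first_ref(2)[OF l] s(3) by simp
qed

lemma big_sums:
  assumes "A \<subseteq> nodes_at big_steps"
  shows "(\<Sum>l\<in>A. l - first_ref l) \<le> 3 * node_count" (is ?A)
    and "(\<Sum>l\<in>A. l - second_ref l) \<le> 3 * node_count" (is ?B)
proof -
  have sub: "big_steps \<subseteq> nondoublings" by (auto simp: big_steps_def)
  have "(\<Sum>l\<in>A. pos l - Suc (smaller (pos l))) \<le> (\<Sum>l\<in>nodes_at big_steps. pos l - Suc (smaller (pos l)))"
    using assms by (intro sum_mono2) (auto simp: nodes_at_def)
  also have "\<dots> \<le> 3 * node_count"
    using sum_nodes_at[OF sub, of "\<lambda>j. j - Suc (smaller j)"] sum_big_offsets_le by simp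
  finally have bound: "(\<Sum>l\<in>A. pos l - Suc (smaller (pos l))) \<le> 3 * node_count" .
  show ?A by (rule order_trans[OF sum_mono bound]) (rule big_node(3)[OF subsetD[OF assms]])
  show ?B
    by (rule order_trans[OF sum_mono bound]) (rule eq_refl[OF big_node(2)[OF subsetD[OF assms]]])
qed

end

section \<open>Counting codes\<close>

text \<open>If the exponents differed, one number would be at least twice the other.\<close>

lemma dyadic_interval_unique:
  fixes n n' :: nat
  assumes "n \<in> {2 ^ m..<2 ^ (m + 1)}" "n' \<in> {2 ^ m..<2 ^ (m + 1)}" and "n * 2 ^ x = n' * 2 ^ y"
  shows "n = n'"
proof -
  have *: "x = y" if "x \<le> y" "n * 2 ^ x = n' * 2 ^ y" "n \<in> {2 ^ m..<2 ^ (m + 1)}" "n' \<in> {2 ^ m..<2 ^ (m + 1)}"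
    for n n' x y :: nat
  proof (rule ccontr)
    assume "x \<noteq> y"
    then have "y = x + Suc (y - x - 1)" using that by simp
    then have "n * 2 ^ x = (n' * (2 * 2 ^ (y - x - 1))) * 2 ^ x"
      using that(2) by (metis mult.assoc mult.commute power_Suc power_add)
    then have "n = n' * (2 * 2 ^ (y - x - 1))" by simp
    moreover have "n' * 2 \<le> n' * (2 * 2 ^ (y - x - 1))" by (intro mult_left_mono) auto
    ultimately have "2 * n' \<le> n" by simp
    then show False using that(3,4) by simp
  qed
  have "x = y" using *[of x y n n'] *[of y x n' n] assms by (cases "x \<le> y") auto
  then show ?thesis using assms by simp
qed

definition references :: "nat \<Rightarrow> nat \<Rightarrow> (nat \<Rightarrow> nat) \<Rightarrow> (nat \<times> nat \<times> nat) set" where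
  "references B t g = {1..t} \<times> (SIGMA q:{1..t}. {..<2 * B + B * g q})"

lemma finite_references: "finite (references B t g)"
  by (simp add: references_def)

text \<open>There are at most \<open>T\<close> choices for the first reference;
  \<open>B * G + 2 * B * T\<close> bounds the number of pairs of second reference and exponent,
  because the exponent range is proportional to a gap and the gaps have bounded sum.\<close>

lemma card_references_le:
  assumes "sum g {1..t} \<le> G" "t \<le> T"
  shows "card (references B t g) \<le> T * (B * G + 2 * B * T)"
proof -
  have "card (references B t g) = t * (2 * B * t + B * sum g {1..t})"
    by (simp add: references_def card_cartesian_product card_SigmaI sum.distrib sum_distrib_left)
  also have "\<dots> \<le> T * (2 * B * T + B * G)"
    using assms by (intro mult_mono add_mono) auto
  finally show ?thesis by (simp add: add.commute)
qed

type_synonym shape = "nat \<times> nat set \<times> nat set"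
type_synonym code_body = "(nat \<Rightarrow> nat) \<times> (nat \<times> nat \<times> nat) set \<times>
  (nat \<Rightarrow> nat) \<times> (nat \<Rightarrow> nat) \<times> (nat \<Rightarrow> nat) \<times> (nat \<Rightarrow> nat) \<times> (nat \<Rightarrow> nat)"

text \<open>A shape \<open>(t, A, A')\<close> consists of the number of nodes and the nodes at tiny and at medium steps.
  A body \<open>(g, P, x, y, z, x', y')\<close> contains the rounded gaps, the unordered triples at tiny steps,
  the offsets \<open>l - p l\<close>, \<open>l - q l\<close> and exponents \<open>e l\<close> at medium steps, and the offsets at big steps,
  where the exponent is always \<open>B\<close>.\<close>

definition shapes :: "nat \<Rightarrow> nat \<Rightarrow> real \<Rightarrow> shape set" where
  "shapes B T r = {(t, A, A'). t \<le> T \<and> A \<subseteq> {1..t} \<and> A' \<subseteq> {1..t} \<and>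
     (1 - 2 / real B) * real (card A) + 2 / 5 * real (card A') \<le> r}"

definition bodies :: "nat \<Rightarrow> nat \<Rightarrow> nat \<Rightarrow> nat \<Rightarrow> shape \<Rightarrow> code_body set" where
  "bodies B G S T = (\<lambda>(t, A, A'). SIGMA g:bounded_seqs {1..t} G.
     {P. P \<subseteq> references B t g \<and> card P \<le> card A} \<times>
     bounded_seqs A' S \<times> bounded_seqs A' S \<times> bounded_seqs A' S \<times>
     bounded_seqs ({1..t} - A - A') (3 * T) \<times> bounded_seqs ({1..t} - A - A') (3 * T))"

text \<open>A relation suffices for counting. The powers of 2 at the end absorb both the final
  doublings and the final padding.\<close>

definition encodes :: "nat \<Rightarrow> nat \<Rightarrow> shape \<times> code_body \<Rightarrow> bool" where
  "encodes B n = (\<lambda>((t, A, A'), (g, P, x, y, z, x', y')).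
     \<exists>g\<^sub>0 V p q e u v. compressed_chain B t g\<^sub>0 V p q e \<and> real n * 2 ^ u = 2 ^ v * V t \<and>
       A \<subseteq> {1..t} \<and> (\<forall>l\<in>{1..t} - A - A'. e l = B) \<and>
       g = restrict g\<^sub>0 {1..t} \<and> P = (\<lambda>l. (p l, q l, e l)) ` A \<and>
       x = restrict (\<lambda>l. l - p l) A' \<and> y = restrict (\<lambda>l. l - q l) A' \<and> z = restrict e A' \<and>
       x' = restrict (\<lambda>l. l - p l) ({1..t} - A - A') \<and> y' = restrict (\<lambda>l. l - q l) ({1..t} - A - A'))"

lemma restrict_eqD: "restrict f A = restrict f' A \<Longrightarrow> x \<in> A \<Longrightarrow> f x = f' x"
  by (metis restrict_apply')

lemma encodes_unique:
  assumes "encodes B n c" "encodes B n' c"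
    and n: "n \<in> {2 ^ m..<2 ^ (m + 1)}" "n' \<in> {2 ^ m..<2 ^ (m + 1)}"
  shows "n = n'"
proof -
  obtain t A A' g P x y z x' y' where c: "c = ((t, A, A'), (g, P, x, y, z, x', y'))"
    by (metis surj_pair)
  define R where "R = {1..t} - A - A'"
  obtain g\<^sub>1 V\<^sub>1 p\<^sub>1 q\<^sub>1 e\<^sub>1 u\<^sub>1 v\<^sub>1 where 1: "compressed_chain B t g\<^sub>1 V\<^sub>1 p\<^sub>1 q\<^sub>1 e\<^sub>1"
    "real n * 2 ^ u\<^sub>1 = 2 ^ v\<^sub>1 * V\<^sub>1 t" "A \<subseteq> {1..t}" "\<forall>l\<in>R. e\<^sub>1 l = B"
    "g = restrict g\<^sub>1 {1..t}" "P = (\<lambda>l. (p\<^sub>1 l, q\<^sub>1 l, e\<^sub>1 l)) ` A"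
    "x = restrict (\<lambda>l. l - p\<^sub>1 l) A'" "y = restrict (\<lambda>l. l - q\<^sub>1 l) A'" "z = restrict e\<^sub>1 A'"
    "x' = restrict (\<lambda>l. l - p\<^sub>1 l) R" "y' = restrict (\<lambda>l. l - q\<^sub>1 l) R"
    using assms(1) unfolding encodes_def c R_def prod.case by blast
  obtain g\<^sub>2 V\<^sub>2 p\<^sub>2 q\<^sub>2 e\<^sub>2 u\<^sub>2 v\<^sub>2 where 2: "compressed_chain B t g\<^sub>2 V\<^sub>2 p\<^sub>2 q\<^sub>2 e\<^sub>2"
    "real n' * 2 ^ u\<^sub>2 = 2 ^ v\<^sub>2 * V\<^sub>2 t" "A \<subseteq> {1..t}" "\<forall>l\<in>R. e\<^sub>2 l = B"
    "g = restrict g\<^sub>2 {1..t}" "P = (\<lambda>l. (p\<^sub>2 l, q\<^sub>2 l, e\<^sub>2 l)) ` A"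
    "x = restrict (\<lambda>l. l - p\<^sub>2 l) A'" "y = restrict (\<lambda>l. l - q\<^sub>2 l) A'" "z = restrict e\<^sub>2 A'"
    "x' = restrict (\<lambda>l. l - p\<^sub>2 l) R" "y' = restrict (\<lambda>l. l - q\<^sub>2 l) R"
    using assms(2) unfolding encodes_def c R_def prod.case by blast
  have "V\<^sub>1 t = V\<^sub>2 t"
  proof (rule compressed_chain_unique[OF 1(1) 2(1) _ 1(3)])
    show "g\<^sub>1 l = g\<^sub>2 l" if "l \<in> {1..t}" for l
      using 1(5) 2(5) restrict_eqD that by metis
    show "(\<lambda>l. (p\<^sub>1 l, q\<^sub>1 l, e\<^sub>1 l)) ` A = (\<lambda>l. (p\<^sub>2 l, q\<^sub>2 l, e\<^sub>2 l)) ` A"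
      using 1(6) 2(6) by simp
    show "p\<^sub>1 l = p\<^sub>2 l \<and> q\<^sub>1 l = q\<^sub>2 l \<and> e\<^sub>1 l = e\<^sub>2 l" if l: "l \<in> {1..t} - A" for l
    proof -
      \<comment> \<open>References are at most \<open>l\<close>, so the truncated offsets determine
        them.\<close>
      have "p\<^sub>1 l \<in> {1..l}" "q\<^sub>1 l \<in> {1..l}" "p\<^sub>2 l \<in> {1..l}" "q\<^sub>2 l \<in> {1..l}"
        using compressed_chain_node(1,2)[OF 1(1)] compressed_chain_node(1,2)[OF 2(1)] l by blast+
      moreover have "l - p\<^sub>1 l = l - p\<^sub>2 l \<and> l - q\<^sub>1 l = l - q\<^sub>2 l \<and> e\<^sub>1 l = e\<^sub>2 l"
      proof (cases "l \<in> A'")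
        case True
        show ?thesis
          using restrict_eqD[OF 1(7)[symmetric, unfolded 2(7)] True]
            restrict_eqD[OF 1(8)[symmetric, unfolded 2(8)] True]
            restrict_eqD[OF 1(9)[symmetric, unfolded 2(9)] True] by simp
      next
        case False
        then have R: "l \<in> R" using l by (simp add: R_def)
        show ?thesis
          using restrict_eqD[OF 1(10)[symmetric, unfolded 2(10)] R]
            restrict_eqD[OF 1(11)[symmetric, unfolded 2(11)] R] 1(4) 2(4) R by simp
      qed
      ultimately show ?thesis by auto
    qed
  qed simp
  then have "real n * 2 ^ u\<^sub>1 * 2 ^ v\<^sub>2 = real n' * 2 ^ u\<^sub>2 * 2 ^ v\<^sub>1"
    using 1(2) 2(2) by (simp add: mult_ac)
  then have "real (n * 2 ^ (u\<^sub>1 + v\<^sub>2)) = real (n' * 2 ^ (u\<^sub>2 + v\<^sub>1))"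
    by (simp add: power_add)
  then have "n * 2 ^ (u\<^sub>1 + v\<^sub>2) = n' * 2 ^ (u\<^sub>2 + v\<^sub>1)" by (simp only: of_nat_eq_iff)
  then show ?thesis by (rule dyadic_interval_unique[OF n])
qed

lemma encodes_exists:
  fixes r :: real
  assumes B: "B \<ge> 2" and n: "n \<in> {2 ^ m..<2 ^ (m + 1)}" and len: "real (chain_length n) \<le> real m + r"
    and K: "chain_length n \<le> K" and T: "T = nat \<lfloor>5 * r\<rfloor>"
  shows "\<exists>c. c \<in> Sigma (shapes B T r) (bodies B (K div B + 1) (K * (1 + B ^ 2) + 2 * B * T) T) \<and> encodes B n c"
proof -
  define S where "S = K * (1 + B ^ 2) + 2 * B * T"
  define k where "k = chain_length n"
  have "n \<ge> 1" using n by (metis atLeastLessThan_iff le_trans one_le_numeral one_le_power)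
  then obtain a where a: "addition_chain a k" "a k = n"
    unfolding k_def using chain_length_attained by blast
  interpret chain_param a k B
    using a B by unfold_locales
  let ?t = node_count and ?A = "nodes_at tiny_steps" and ?A' = "nodes_at medium_steps"
  let ?R = "{1..?t} - ?A - ?A'"
  \<comment> \<open>\<open>n \<ge> 2 ^ m\<close> together with length at most \<open>m + r\<close>
    bounds the total loss by \<open>r\<close>.\<close>
  have "log 2 (2 ^ m) \<le> log 2 (real n)"
    using n by (subst log_le_cancel_iff) auto
  then have loss: "real k - log 2 (real (a k)) \<le> r"
    using len unfolding a(2) by (simp add: k_def log_nat_power)
  have t: "?t \<le> T"
    using card_nondoublings_le loss unfolding T by (simp add: le_nat_floor)
  have card: "card ?A = card tiny_steps" "card ?A' = card medium_steps"
    by (intro card_nodes_at; auto simp: tiny_steps_def medium_steps_def)+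
  have sub: "?A \<subseteq> {1..?t}" "?A' \<subseteq> {1..?t}" by (auto simp: nodes_at_def)
  have R: "?R \<subseteq> nodes_at big_steps"
    using pos_nondoubling(1) by (auto simp: nodes_at_def medium_steps_def)
  have shape: "(?t, ?A, ?A') \<in> shapes B T r"
    using weighted_steps_le loss t sub by (simp add: shapes_def card)
  have kK: "k \<le> K" using K by (simp add: k_def)
  have S: "k * (1 + B ^ 2) + 2 * B * ?t \<le> S"
    unfolding S_def using kK t by (intro add_mono mult_right_mono mult_left_mono) auto
  have g: "restrict gap {1..?t} \<in> bounded_seqs {1..?t} (K div B + 1)"
    using sum_gap_le kK div_le_mono[OF kK, of B] by (intro restrict_in_bounded_seqs) linarith
  have P: "(\<lambda>l. (first_ref l, second_ref l, exponent l)) ` ?A \<subseteq> references B ?t (restrict gap {1..?t})"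
  proof (rule image_subsetI)
    fix l assume "l \<in> ?A"
    then have l: "l \<in> {1..?t}" by (simp add: nodes_at_def)
    then show "(first_ref l, second_ref l, exponent l) \<in> references B ?t (restrict gap {1..?t})"
      using first_ref(1)[OF l] second_ref(1,3)[OF l] by (auto simp: references_def)
  qed
  have Pc: "card ((\<lambda>l. (first_ref l, second_ref l, exponent l)) ` ?A) \<le> card ?A"
    by (intro card_image_le) (auto simp: nodes_at_def)
  let ?body = "(restrict gap {1..?t}, (\<lambda>l. (first_ref l, second_ref l, exponent l)) ` ?A,
    restrict (\<lambda>l. l - first_ref l) ?A', restrict (\<lambda>l. l - second_ref l) ?A', restrict exponent ?A',
    restrict (\<lambda>l. l - first_ref l) ?R, restrict (\<lambda>l. l - second_ref l) ?R)"
  have "?body \<in> bodies B (K div B + 1) S T (?t, ?A, ?A')"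
    unfolding bodies_def prod.case
  proof (intro SigmaI CollectI conjI g P Pc restrict_in_bounded_seqs)
    show "(\<Sum>l\<in>?A'. l - first_ref l) \<le> S" "(\<Sum>l\<in>?A'. l - second_ref l) \<le> S" "sum exponent ?A' \<le> S"
      using medium_sums S by linarith+
    show "(\<Sum>l\<in>?R. l - first_ref l) \<le> 3 * T" "(\<Sum>l\<in>?R. l - second_ref l) \<le> 3 * T"
      using big_sums[OF R] t by linarith+
  qed
  moreover have "encodes B n ((?t, ?A, ?A'), ?body)"
    unfolding encodes_def prod.case
  proof (intro exI conjI)
    show "compressed_chain B ?t gap val first_ref second_ref exponent" by (rule compressed)
    show "real n * 2 ^ padding ?t = 2 ^ (k - pos ?t) * val ?t" using last_val by (simp add: a)
    show "\<forall>l\<in>?R. exponent l = B" using big_node(1) R by blast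
  qed (use sub in auto)
  ultimately show ?thesis
    using shape unfolding S_def by (intro exI[of _ "((?t, ?A, ?A'), ?body)"]) auto
qed

lemma card_shapes_le: "finite (shapes B T r)" "card (shapes B T r) \<le> (T + 1) * 4 ^ T"
proof -
  have sub: "shapes B T r \<subseteq> {..T} \<times> Pow {1..T} \<times> Pow {1..T}"
    by (fastforce simp: shapes_def)
  show "finite (shapes B T r)" by (rule finite_subset[OF sub]) auto
  have "card (shapes B T r) \<le> card ({..T} \<times> Pow {1..T} \<times> Pow {1..T})"
    by (intro card_mono sub) auto
  also have "\<dots> = (T + 1) * (2 ^ T * 2 ^ T)"
    by (simp add: card_cartesian_product card_Pow)
  finally show "card (shapes B T r) \<le> (T + 1) * 4 ^ T"
    by (simp flip: power_mult_distrib)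
qed

text \<open>\<open>Q\<close> bounds jointly the factors \<open>N\<close> per tiny step and
  \<open>1 / (1 - z)\<close> per medium sequence entry, under the loss budget. The gaps and the two
  big-step sequences are counted with the weight \<open>1 / 2\<close>, the three medium ones with
  \<open>z\<close>.\<close>

lemma card_bodies_le:
  fixes N Q z r :: real
  assumes s: "(t, A, A') \<in> shapes B T r" and N: "N = real (B * G + 2 * B * T)" "N \<ge> 1"
    and z: "0 < z" "z < 1"
    and Q: "\<And>i j :: nat. (1 - 2 / real B) * real i + 2 / 5 * real j \<le> r \<Longrightarrow> N ^ i * (1 / (1 - z)) ^ (3 * j) \<le> Q"
  shows "finite (bodies B G S T (t, A, A'))" and
    "real (card (bodies B G S T (t, A, A'))) \<le> 2 ^ (G + T) * (exp (real T) * (1 / z) ^ (3 * S) * 2 ^ (8 * T) * Q)"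
proof -
  let ?R = "{1..t} - A - A'"
  have t: "t \<le> T" "A \<subseteq> {1..t}" "A' \<subseteq> {1..t}"
    and w: "(1 - 2 / real B) * real (card A) + 2 / 5 * real (card A') \<le> r"
    using s by (auto simp: shapes_def)
  have fin: "finite A" "finite A'" using t by (auto intro: finite_subset)
  define X where "X g = {P. P \<subseteq> references B t g \<and> card P \<le> card A} \<times>
     bounded_seqs A' S \<times> bounded_seqs A' S \<times> bounded_seqs A' S \<times>
     bounded_seqs ?R (3 * T) \<times> bounded_seqs ?R (3 * T)" for g
  have bodies: "bodies B G S T (t, A, A') = Sigma (bounded_seqs {1..t} G) X"
    by (simp add: bodies_def X_def[abs_def])
  have finP: "finite {P. P \<subseteq> references B t g \<and> card P \<le> card A}" for g
    using finite_references[of B t g] by (auto intro: finite_subset[of _ "Pow (references B t g)"])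
  have finX: "finite (X g)" for g
    unfolding X_def using fin finP by (intro finite_cartesian_product finite_bounded_seqs) auto
  show "finite (bodies B G S T (t, A, A'))"
    unfolding bodies using finX by (intro finite_SigmaI finite_bounded_seqs) auto
  define M where "M = exp (real T) * (1 / z) ^ (3 * S) * 2 ^ (8 * T) * Q"
  have half: "real (card (bounded_seqs D U)) \<le> 2 ^ (U + T)" if "D \<subseteq> {1..t}" for D :: "nat set" and U
  proof -
    have "card D \<le> T" using card_mono[OF _ that] t by simp
    have "real (card (bounded_seqs D U)) \<le> 2 ^ U * 2 ^ card D"
      using card_bounded_seqs_le[of D "1 / 2" U] that by (auto intro: finite_subset)
    also have "\<dots> \<le> 2 ^ U * 2 ^ T"
      using \<open>card D \<le> T\<close> by (intro mult_left_mono power_increasing) auto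
    finally show ?thesis by (simp add: power_add)
  qed
  have X: "real (card (X g)) \<le> M" if g: "g \<in> bounded_seqs {1..t} G" for g
  proof -
    have "card (references B t g) \<le> T * (B * G + 2 * B * T)"
      using g t by (intro card_references_le) (auto simp: bounded_seqs_def)
    \<comment> \<open>\<open>N\<close> is chosen so that the exponential in the subset bound is at
      most \<open>exp T\<close>.\<close>
    then have "real (card (references B t g)) \<le> real T * N"
      unfolding N(1) by (metis of_nat_le_iff of_nat_mult)
    then have "real (card (references B t g)) / N \<le> real T"
      using N(2) by (simp add: field_simps)
    moreover have "real (card {P. P \<subseteq> references B t g \<and> card P \<le> card A})
        \<le> N ^ card A * exp (real (card (references B t g)) / N)"
      by (rule card_small_subsets_le[OF finite_references N(2)])
    ultimately have P: "real (card {P. P \<subseteq> references B t g \<and> card P \<le> card A}) \<le> N ^ card A * exp (real T)"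
      using N(2) by (smt (verit) exp_le_cancel_iff mult_left_mono zero_le_power)
    define b where "b = real (card (bounded_seqs A' S))"
    define d where "d = real (card (bounded_seqs ?R (3 * T)))"
    have b: "b \<le> (1 / z) ^ S * (1 / (1 - z)) ^ card A'"
      unfolding b_def using z by (intro card_bounded_seqs_le fin)
    have d: "d \<le> 2 ^ (4 * T)" unfolding d_def using half[of ?R "3 * T"] by auto
    have nn: "b \<ge> 0" "d \<ge> 0" by (simp_all add: b_def d_def)
    have "real (card (X g)) = real (card {P. P \<subseteq> references B t g \<and> card P \<le> card A}) * (b ^ 3 * d ^ 2)"
      by (simp add: X_def card_cartesian_product b_def d_def power3_eq_cube power2_eq_square)
    also have "\<dots> \<le> (N ^ card A * exp (real T)) * (((1 / z) ^ S * (1 / (1 - z)) ^ card A') ^ 3 * (2 ^ (4 * T)) ^ 2)"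
      using P b d nn N(2) by (intro mult_mono power_mono) auto
    also have "\<dots> = exp (real T) * (1 / z) ^ (3 * S) * 2 ^ (8 * T) * (N ^ card A * (1 / (1 - z)) ^ (3 * card A'))"
      by (simp add: power_mult_distrib mult_ac flip: power_mult)
    also have "\<dots> \<le> M"
      unfolding M_def using Q[OF w] z by (intro mult_left_mono) auto
    finally show ?thesis .
  qed
  \<comment> \<open>The zero sequence supplies some \<open>g\<close>, and
    \<open>0 \<le> card (X g) \<le> M\<close> gives the sign of \<open>M\<close>.\<close>
  have "bounded_seqs {1..t} G \<noteq> {}"
    using restrict_in_bounded_seqs[of "\<lambda>_. 0" "{1..t}" G] by auto
  then have "M \<ge> 0" using X by (metis ex_in_conv of_nat_0_le_iff order_trans)
  have "real (card (bodies B G S T (t, A, A'))) \<le> real (card (bounded_seqs {1..t} G)) * M"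
    unfolding bodies using finX X by (intro card_Sigma_le finite_bounded_seqs) auto
  also have "\<dots> \<le> 2 ^ (G + T) * M"
    using half[of "{1..t}" G] \<open>M \<ge> 0\<close> by (intro mult_right_mono) auto
  finally show "real (card (bodies B G S T (t, A, A')))
      \<le> 2 ^ (G + T) * (exp (real T) * (1 / z) ^ (3 * S) * 2 ^ (8 * T) * Q)"
    by (simp add: M_def)
qed

lemma F_le:
  fixes N Q z r :: real
  assumes B: "B \<ge> 2" and r: "r \<ge> 0" and K: "K = nat \<lfloor>real m + r\<rfloor>" and T: "T = nat \<lfloor>5 * r\<rfloor>"
    and G: "G = K div B + 1" and S: "S = K * (1 + B ^ 2) + 2 * B * T"
    and N: "N = real (B * G + 2 * B * T)"
    and z: "0 < z" "z < 1"
    and Q: "\<And>i j :: nat. (1 - 2 / real B) * real i + 2 / 5 * real j \<le> r \<Longrightarrow> N ^ i * (1 / (1 - z)) ^ (3 * j) \<le> Q"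
  shows "real (F m r) \<le> (real T + 1) * 4 ^ T * (2 ^ (G + T) * (exp (real T) * (1 / z) ^ (3 * S) * 2 ^ (8 * T) * Q))"
proof -
  let ?X = "{n \<in> {2 ^ m..<2 ^ (m + 1)}. real (chain_length n) \<le> real m + r}"
  let ?C = "Sigma (shapes B T r) (bodies B G S T)"
  define M where "M = 2 ^ (G + T) * (exp (real T) * (1 / z) ^ (3 * S) * 2 ^ (8 * T) * Q)"
  have "1 * 1 \<le> B * G" using B G by (intro mult_mono) auto
  then have "N \<ge> 1" unfolding N by linarith
  note bodies = card_bodies_le[OF _ N \<open>N \<ge> 1\<close> z Q]
  have fin: "finite (bodies B G S T s)" and card: "real (card (bodies B G S T s)) \<le> M"
    if "s \<in> shapes B T r" for s
    using bodies[of "fst s" "fst (snd s)" "snd (snd s)"] that by (auto simp: M_def)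
  have "card ?X \<le> card ?C"
  proof (rule card_le_if_inj_on_rel[where r = "encodes B"])
    show "finite ?C" using card_shapes_le(1) fin by (intro finite_SigmaI)
    show "\<exists>c. c \<in> ?C \<and> encodes B n c" if "n \<in> ?X" for n
    proof -
      have "chain_length n \<le> K" using that unfolding K by (intro le_nat_floor) auto
      then show ?thesis unfolding G S
        using that by (intro encodes_exists[OF B _ _ _ T]) auto
    qed
    show "n = n'" if "n \<in> ?X" "n' \<in> ?X" "c \<in> ?C" "encodes B n c" "encodes B n' c" for n n' c
      using that encodes_unique by blast
  qed
  then have "real (F m r) \<le> real (card ?C)" by (simp add: F_def)
  also have "\<dots> \<le> real (card (shapes B T r)) * M"
    using card_shapes_le(1) fin card by (intro card_Sigma_le)
  also have "\<dots> \<le> real ((T + 1) * 4 ^ T) * M"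
  proof (rule mult_right_mono)
    have "Q \<ge> 1" using Q[of 0 0] r by simp
    then show "M \<ge> 0" using z by (simp add: M_def)
  qed (use card_shapes_le(2) in \<open>simp only: of_nat_le_iff\<close>)
  also have "real ((T + 1) * 4 ^ T) = (real T + 1) * 4 ^ T" by (simp add: algebra_simps)
  finally show ?thesis unfolding M_def .
qed

section \<open>Asymptotics\<close>

lemma F_exp_bound:
  fixes c D x :: real
  assumes c: "c > 0" and x: "x = ln (real m)" "x \<ge> 4" "x \<ge> c" "30 * ln (2 * x) \<le> x"
    and D: "D = ln (4 + 20 * c)"
  shows "real (F m (c * real m / x)) \<le> exp (c * real m + (129 * c + 27 + 5 * c * D) * (real m / x))"
proof -
  define r where "r = c * real m / x"
  define B where "B = nat \<lceil>x\<rceil>"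
  define K where "K = nat \<lfloor>real m + r\<rfloor>"
  define T where "T = nat \<lfloor>5 * r\<rfloor>"
  define G where "G = K div B + 1"
  define S where "S = K * (1 + B ^ 2) + 2 * B * T"
  define N where "N = real (B * G + 2 * B * T)"
  \<comment> \<open>\<open>S\<close> is of order \<open>m * B ^ 2\<close>, so with
    \<open>z = 1 - \<theta>\<close> the factor \<open>(1 / z) ^ (3 * S)\<close> costs only
    \<open>exp (O (m / x))\<close>, while a medium step costs
    \<open>(1 / \<theta>) ^ 3 = B ^ 12\<close>.\<close>
  define \<theta> where "\<theta> = 1 / real B ^ 4"
  \<comment> \<open>\<open>x + D\<close> bounds \<open>ln N\<close>, and \<open>1 + 4 / x\<close>
    compensates the weight \<open>1 - 2 / B\<close>: the product is at least 1 exactly because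
    \<open>x \<ge> 4\<close>.\<close>
  define Q where "Q = exp (r * (x + D) * (1 + 4 / x))"
  have m: "real m > 0" using x by (cases "m = 0") auto
  have xm: "x \<le> real m" using x(1) ln_le_minus_one[OF m] by simp
  have Bx: "x \<le> real B" "real B \<le> 2 * x" "real B \<ge> 4"
    unfolding B_def using x(2) by linarith+
  then have B: "B \<ge> 2" by simp
  have D0: "D \<ge> 0" unfolding D using c by simp
  have r: "r \<ge> 0" "r \<le> real m" "x * r = c * real m"
  proof -
    show "r \<ge> 0" "x * r = c * real m" unfolding r_def using c m x(2) by auto
    have "c * real m \<le> x * real m" using x(3) m by (intro mult_right_mono) auto
    then show "r \<le> real m" unfolding r_def using x(2) by (simp add: pos_divide_le_eq mult.commute)
  qed
  have K: "real K \<le> 2 * real m" "real K \<ge> real m"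
  proof -
    show "real K \<le> 2 * real m" unfolding K_def using r by linarith
    have "m \<le> K" unfolding K_def using r by (intro le_nat_floor) auto
    then show "real K \<ge> real m" by simp
  qed
  have T: "real T \<le> 5 * r" unfolding T_def using r by linarith
  have G: "real G \<le> 2 * real m / x + 1"
  proof -
    have "real (K div B) \<le> real K / real B" by (rule of_nat_div_le_of_nat)
    also have "\<dots> \<le> 2 * real m / x" using K Bx x(2) by (intro frac_le) auto
    finally show ?thesis by (simp add: G_def)
  qed
  have \<theta>: "0 < \<theta>" "\<theta> \<le> 1 / 2"
  proof -
    have "real B ^ 1 \<le> real B ^ 4" using Bx by (intro power_increasing) auto
    then have "real B ^ 4 \<ge> 2" using Bx unfolding power_one_right by linarith
    then show "0 < \<theta>" "\<theta> \<le> 1 / 2"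
      unfolding \<theta>_def using Bx(3) frac_le[of 1 1 2 "real B ^ 4"] by simp_all
  qed
  have S: "real S * \<theta> \<le> 4 * real m / x + 10 * r"
  proof -
    have "1 + real B ^ 2 \<le> 2 * real B ^ 2" using Bx by simp
    then have "real K * (1 + real B ^ 2) \<le> (2 * real m) * (2 * real B ^ 2)"
      using K m by (intro mult_mono) auto
    moreover have "real B * real T \<le> real B * (5 * r)" using T by (intro mult_left_mono) auto
    moreover have "real S = real K * (1 + real B ^ 2) + 2 * (real B * real T)"
      by (simp add: S_def algebra_simps)
    ultimately have "real S \<le> 4 * real m * real B ^ 2 + 10 * r * real B"
      by (simp add: algebra_simps)
    also have "\<dots> \<le> 4 * real m / x * real B ^ 4 + 10 * r * real B ^ 4"
    proof (rule add_mono)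
      have "real B * 1 \<le> real B * real B" using Bx by (intro mult_left_mono) auto
      then have "x \<le> real B ^ 2" using Bx unfolding power2_eq_square by linarith
      then have "4 * real m / x * real B ^ 2 * x \<le> 4 * real m / x * real B ^ 2 * real B ^ 2"
        using m x(2) by (intro mult_left_mono) auto
      then show "4 * real m * real B ^ 2 \<le> 4 * real m / x * real B ^ 4"
        using x(2) by (simp add: power2_eq_square power4_eq_xxxx mult_ac)
      have "real B ^ 1 \<le> real B ^ 4" using Bx by (intro power_increasing) auto
      then show "10 * r * real B \<le> 10 * r * real B ^ 4" using r by (intro mult_left_mono) auto
    qed
    finally show ?thesis
      unfolding \<theta>_def using Bx by (simp add: field_simps)
  qed
  have N: "real m \<le> N" "ln N \<le> x + D"
  proof -
    have "real B * real (K div B) \<le> real K"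
      by (metis of_nat_le_iff of_nat_mult times_div_less_eq_dividend)
    moreover have "K < B * G"
      using dividend_less_times_div[of B K] B by (simp add: G_def)
    moreover have "real B * real T \<le> (2 * x) * (5 * r)" using T Bx x(2) by (intro mult_mono) auto
    ultimately have "N \<le> 2 * real m + 2 * x + 20 * (x * r)"
      unfolding N_def using K Bx by (simp add: G_def algebra_simps)
    have "real K \<le> real (B * G)" using \<open>K < B * G\<close> by linarith
    then show "real m \<le> N" unfolding N_def of_nat_add using K(2) by linarith
    \<comment> \<open>By \<open>x \<le> m\<close> and \<open>x * r = c * m\<close>; this is the
      origin of \<open>D\<close>.\<close>
    have "N \<le> (4 + 20 * c) * real m"
      using \<open>N \<le> _\<close> xm unfolding r(3) by (simp add: algebra_simps)
    then have "ln N \<le> ln ((4 + 20 * c) * real m)"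
      using \<open>real m \<le> N\<close> m by (intro ln_mono) auto
    also have "\<dots> = x + D" using c m by (simp add: ln_mult D x(1))
    finally show "ln N \<le> x + D" .
  qed
  have Q: "N ^ i * (1 / (1 - (1 - \<theta>))) ^ (3 * j) \<le> Q"
    if ij: "(1 - 2 / real B) * real i + 2 / 5 * real j \<le> r" for i j :: nat
  proof -
    define w where "w = 1 + 4 / x"
    have w: "w \<ge> 1" "1 \<le> w * (1 - 2 / real B)"
    proof -
      show "w \<ge> 1" using x(2) by (simp add: w_def)
      have "2 / real B \<le> 2 / x" using Bx x(2) by (intro divide_left_mono) auto
      then have "w * (1 - 2 / real B) \<ge> w * (1 - 2 / x)" using \<open>w \<ge> 1\<close> by (intro mult_left_mono) auto
      moreover have "w * (1 - 2 / x) \<ge> 1" unfolding w_def using x(2) by (simp add: field_simps)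
      ultimately show "1 \<le> w * (1 - 2 / real B)" by simp
    qed
    \<comment> \<open>The assumption on \<open>30 * ln (2 * x)\<close> is \<open>12 * 5 / 2\<close>:
      it makes \<open>B ^ 12\<close> cost at most \<open>2 / 5\<close> of a tiny step, the same
      proportion as in the loss budget.\<close>
    have "ln (real B) \<le> ln (2 * x)" using Bx by simp
    then have lnB: "12 * ln (real B) \<le> 2 / 5 * (x + D)" using x(4) D0 by simp
    have "real i \<le> real i * (w * (1 - 2 / real B))" using mult_left_mono[OF w(2), of "real i"] by simp
    moreover have "2 / 5 * real j \<le> w * (2 / 5 * real j)" using w by (intro mult_le_cancel_right1[THEN iffD2]) auto
    moreover have "w * ((1 - 2 / real B) * real i + 2 / 5 * real j) \<le> w * r"
      using w ij by (intro mult_left_mono) auto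
    ultimately have wr: "real i + 2 / 5 * real j \<le> w * r" by (simp add: algebra_simps)
    have "N ^ i * (1 / (1 - (1 - \<theta>))) ^ (3 * j) = exp (real i * ln N + real j * (12 * ln (real B)))"
    proof -
      have "N ^ i = exp (real i * ln N)" using N(1) m by (simp add: exp_of_nat_mult)
      moreover have "(1 / (1 - (1 - \<theta>))) ^ (3 * j) = exp (real j * (12 * ln (real B)))"
      proof -
        have "(1 / (1 - (1 - \<theta>))) ^ (3 * j) = (real B ^ 4) ^ (3 * j)" by (simp add: \<theta>_def)
        also have "\<dots> = real B ^ (12 * j)" by (simp flip: power_mult)
        also have "\<dots> = exp (real (12 * j) * ln (real B))"
          unfolding exp_of_nat_mult using Bx by simp
        finally show ?thesis by (simp add: mult_ac)
      qed
      ultimately show ?thesis by (simp add: exp_add)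
    qed
    also have "\<dots> \<le> exp (real i * (x + D) + real j * (2 / 5 * (x + D)))"
      using N(2) lnB by (intro exp_le_cancel_iff[THEN iffD2] add_mono mult_left_mono) auto
    also have "real i * (x + D) + real j * (2 / 5 * (x + D)) = (real i + 2 / 5 * real j) * (x + D)"
      by (simp add: algebra_simps)
    also have "exp ((real i + 2 / 5 * real j) * (x + D)) \<le> exp (w * r * (x + D))"
      using wr D0 x(2) by (simp add: mult_right_mono)
    also have "\<dots> = Q" by (simp add: Q_def w_def mult_ac)
    finally show ?thesis .
  qed
  have "real (F m r) \<le> (real T + 1) * 4 ^ T *
      (2 ^ (G + T) * (exp (real T) * (1 / (1 - \<theta>)) ^ (3 * S) * 2 ^ (8 * T) * Q))"
    using B r(1) K_def T_def G_def S_def N_def _ _ Q by (rule F_le) (use \<theta> in auto)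
  also have "\<dots> \<le> exp (real T) * exp (2 * real T) *
      (exp (real (G + T)) * (exp (real T) * exp (6 * (real S * \<theta>)) * exp (8 * real T) * Q))"
  proof -
    have two: "2 ^ j \<le> exp (real j)" for j
    proof -
      have "(2::real) ^ j \<le> exp 1 ^ j" using exp_ge_add_one_self[of 1] by (intro power_mono) auto
      then show ?thesis by (simp flip: exp_of_nat_mult)
    qed
    have "1 / (1 - \<theta>) \<le> 1 + 2 * \<theta>" using \<theta> by (simp add: field_simps)
    also have "\<dots> \<le> exp (2 * \<theta>)" by (rule exp_ge_add_one_self)
    finally have "(1 / (1 - \<theta>)) ^ (3 * S) \<le> exp (2 * \<theta>) ^ (3 * S)" using \<theta> by (intro power_mono) auto
    also have "\<dots> = exp (6 * (real S * \<theta>))" by (simp flip: exp_of_nat_mult)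
    finally have S': "(1 / (1 - \<theta>)) ^ (3 * S) \<le> exp (6 * (real S * \<theta>))" .
    have T4: "(4::real) ^ T \<le> exp (2 * real T)" using two[of "2 * T"] by (simp add: power_mult)
    have T8: "(2::real) ^ (8 * T) \<le> exp (8 * real T)" using two[of "8 * T"] by simp
    have T1: "real T + 1 \<le> exp (real T)" using exp_ge_add_one_self[of "real T"] by (simp add: add.commute)
    have "0 \<le> Q" "0 \<le> 1 / (1 - \<theta>)" using \<theta> by (auto simp: Q_def)
    then show ?thesis
      by (intro mult_mono T1 T4 two S' T8 order_refl mult_nonneg_nonneg zero_le_power exp_ge_zero) auto
  qed
  also have "\<dots> = exp (13 * real T + real G + 6 * (real S * \<theta>) + r * (x + D) * (1 + 4 / x))"
    by (simp add: Q_def flip: exp_add)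
  also have "\<dots> \<le> exp (c * real m + (129 * c + 27 + 5 * c * D) * (real m / x))"
  proof -
    \<comment> \<open>Only \<open>r * x = c * m\<close> is of main order. The rest collects
      \<open>65 + 60 + 4 = 129\<close> multiples of \<open>r\<close>, \<open>3 + 24 = 27\<close> of
      \<open>m / x\<close> (the 1 in the bound for \<open>G\<close> is at most \<open>m / x\<close>)
      and 5 of \<open>r * D\<close>.\<close>
    have "r * (x + D) * (1 + 4 / x) = c * real m + r * D + 4 * r + 4 * (r * D / x)"
      using x(2) r(3) by (simp add: field_simps)
    moreover have "4 * (r * D / x) \<le> 4 * (r * D)"
      using x(2) r(1) D0 divide_left_mono[of 1 x "r * D"] by simp
    moreover have "1 \<le> real m / x" using xm x(2) by simp
    moreover have "real G \<le> 2 * (real m / x) + 1" "real S * \<theta> \<le> 4 * (real m / x) + 10 * r"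
      using G S by simp_all
    ultimately have "13 * real T + real G + 6 * (real S * \<theta>) + r * (x + D) * (1 + 4 / x)
        \<le> c * real m + 129 * r + 27 * (real m / x) + 5 * (r * D)"
      using T by linarith
    also have "\<dots> = c * real m + (129 * c + 27 + 5 * c * D) * (real m / x)"
      by (simp add: r_def algebra_simps)
    finally show ?thesis by simp
  qed
  finally show ?thesis by (simp add: r_def)
qed

theorem theorem1:
  fixes c \<epsilon> :: real
  assumes "0 < c" and "c < ln 2" and "\<epsilon> > 0"
  shows "\<forall>\<^sub>F m :: nat in sequentially.
    real (F m (c * real m / ln (real m)))
      < exp (c * real m + \<epsilon> * real m * ln (ln (real m)) / ln (real m))"
proof -
  define D where "D = ln (4 + 20 * c)"
  define C where "C = 129 * c + 27 + 5 * c * D"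
  have "\<forall>\<^sub>F m :: nat in sequentially. 4 \<le> ln (real m)" by real_asymp
  moreover have "\<forall>\<^sub>F m :: nat in sequentially. c \<le> ln (real m)" by real_asymp
  moreover have "\<forall>\<^sub>F m :: nat in sequentially. 30 * ln (2 * ln (real m)) \<le> ln (real m)" by real_asymp
  \<comment> \<open>The error obtained is \<open>C * m / ln m\<close>; eventually the iterated
    logarithm exceeds the constant \<open>C / \<epsilon>\<close>, which also makes the inequality
    strict.\<close>
  moreover have "\<forall>\<^sub>F m :: nat in sequentially. C / \<epsilon> < ln (ln (real m))" by real_asymp
  ultimately show ?thesis
  proof eventually_elim
    case (elim m)
    have m: "real m > 0" using elim(1) by (cases "m = 0") auto
    have "C < \<epsilon> * ln (ln (real m))" using elim(4) assms(3) by (simp add: field_simps)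
    moreover have "ln (real m) > 0" using elim(1) by linarith
    ultimately have "C * (real m / ln (real m)) < \<epsilon> * ln (ln (real m)) * (real m / ln (real m))"
      using m by (intro mult_strict_right_mono divide_pos_pos)
    then have "c * real m + C * (real m / ln (real m))
        < c * real m + \<epsilon> * real m * ln (ln (real m)) / ln (real m)"
      by (simp add: mult_ac)
    moreover have "real (F m (c * real m / ln (real m)))
        \<le> exp (c * real m + C * (real m / ln (real m)))"
      unfolding C_def using F_exp_bound[OF assms(1) refl elim(1-3) D_def] .
    ultimately show ?case by (meson exp_less_cancel_iff order_le_less_trans)
  qed
qed

end
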